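(* Let $P_1,\ldots,P_N$ be discrete probability measures on $\mathbb{R}^d$. Let $\bar{P}$ be a Wasserstein barycenter of $P_1,\ldots,P_N$, i.e. a probability measure $\bar P\in\mathcal{P}^2(\mathbb{R}^d)$ with $$\sum_{i=1}^N W_2(\bar{P},P_i)^2=\inf_{P\in\mathcal{P}^2(\mathbb{R}^d)}\sum_{i=1}^N W_2(P,P_i)^2,$$ and let $X$ be a random variable with distribution $\bar{P}$. Then there exist finite convex functions $\psi_i:\mathbb{R}^d\to\mathbb{R}$, $i=1,\ldots,N$ (differentiable at every point of $\operatorname{supp}(\bar P)$, so that the following expressions make sense), such that: (i) $\nabla\psi_i(\bar{P})=P_i$ for all $i$; (ii) $E|X-\nabla\psi_i(X)|^2=W_2(\bar{P},P_i)^2$ for all $i$; (iii) $\frac{1}{N}\sum_{i=1}^N\nabla\psi_i(x_j)=x_j$ for all $x_j\in\operatorname{supp}(\bar{P})$; (iv) $\frac{1}{N}\sum_{i=1}^N\psi_i(x_j)=\frac{|x_j|^2}{2}$ for all $x_j\in\operatorname{supp}(\bar{P})$.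
   Context: A discrete probability measure on $\mathbb{R}^d$ is a probability measure with finite support. $\mathcal{P}^2(\mathbb{R}^d)$ is the set of all probability measures on $\mathbb{R}^d$ with finite second moments. $W_2$ is the quadratic Wasserstein distance: $W_2(P,Q)^2=\inf E|X-Y|^2$ over all couplings $(X,Y)$ with $X\sim P$, $Y\sim Q$, with $|\cdot|$ the Euclidean norm. For a map $\varphi$, $\varphi(\bar P)$ denotes the push-forward of the measure $\bar P$ under $\varphi$. *)

theory Defs
  imports "HOL-Probability.Probability"
begin

definition borel_prob :: "'a::euclidean_space measure \<Rightarrow> bool" where
  "borel_prob P \<longleftrightarrow> prob_space P \<and> sets P = sets borel"

definition supp :: "'a::euclidean_space measure \<Rightarrow> 'a set" where
  "supp P = {x. \<forall>U. open U \<longrightarrow> x \<in> U \<longrightarrow> 0 < emeasure P U}"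

definition discrete_prob :: "'a::euclidean_space measure \<Rightarrow> bool" where
  "discrete_prob P \<longleftrightarrow> borel_prob P \<and> finite (supp P)"

definition P2 :: "'a::euclidean_space measure set" where
  "P2 = {P. borel_prob P \<and> (\<integral>\<^sup>+x. ennreal ((norm x)\<^sup>2) \<partial>P) < \<infinity>}"

text \<open>A coupling \<open>(X, Y)\<close> is represented by its joint law on the product space.\<close>

definition couplings ::
  "'a::euclidean_space measure \<Rightarrow> 'a measure \<Rightarrow> ('a \<times> 'a) measure set" where
  "couplings P Q = {\<gamma>. prob_space \<gamma> \<and> sets \<gamma> = sets (borel \<Otimes>\<^sub>M borel) \<and>
     distr \<gamma> borel fst = P \<and> distr \<gamma> borel snd = Q}"

text \<open>The infimum is taken in the extended nonnegative reals; for measures with finite second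
  moments it is finite, so the conversion to the reals loses nothing there.\<close>

definition W2 :: "'a::euclidean_space measure \<Rightarrow> 'a measure \<Rightarrow> real" where
  "W2 P Q = sqrt (enn2real
     (INF \<gamma>\<in>couplings P Q. \<integral>\<^sup>+z. ennreal ((norm (fst z - snd z))\<^sup>2) \<partial>\<gamma>))"

text \<open>The infimum below is over a nonempty set of reals bounded below by 0.\<close>

definition wasserstein_barycenter ::
  "nat \<Rightarrow> (nat \<Rightarrow> 'a::euclidean_space measure) \<Rightarrow> 'a measure \<Rightarrow> bool" where
  "wasserstein_barycenter N P Pbar \<longleftrightarrow> Pbar \<in> P2 \<and>
     (\<Sum>i = 1..N. (W2 Pbar (P i))\<^sup>2) = (INF Q\<in>P2. \<Sum>i = 1..N. (W2 Q (P i))\<^sup>2)"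

text \<open>At points where \<open>f\<close> is not differentiable, \<open>grad f\<close> takes one fixed unspecified value,
  since there the description is of the constantly false predicate. Hence, for convex \<open>f\<close>,
  \<open>grad f\<close> is Borel measurable and its push-forwards are meaningful.\<close>

definition grad :: "('a::euclidean_space \<Rightarrow> real) \<Rightarrow> 'a \<Rightarrow> 'a" where
  "grad f x = (THE v. GDERIV f x :> v)"

end

theory Submission
  imports Defs
begin

text \<open>
  The barycenter problem is dual to a finite linear programme. Write \<open>S\<^sub>i\<close> for the finite support of
  \<open>P\<^sub>i\<close>. A transport plan on \<open>S\<^sub>1 \<times> \<dots> \<times> S\<^sub>N\<close> with marginals \<open>P\<^sub>i\<close>, pushed forward by the mean, has
  objective value at most its multi-marginal cost for
  \<open>c s = \<Sum>i. \<bar>avg s - s\<^sub>i\<bar>\<^sup>2\<close> (\<open>barycenter_le_multimarginal_cost\<close>). Linear programming duality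
  (\<open>multimarginal_duality\<close>, from \<open>farkas\<close>) therefore provides functions \<open>u\<^sub>i\<close> on \<open>S\<^sub>i\<close> with
  \<open>\<Sum>i. u\<^sub>i (s\<^sub>i) \<le> c s\<close> whose total integral \<open>\<Sum>i. \<integral>u\<^sub>i dP\<^sub>i\<close> is at least the infimum in the barycenter
  problem.

  Put \<open>\<phi>\<^sub>i x = min {\<bar>x - y\<bar>\<^sup>2 - u\<^sub>i y | y \<in> S\<^sub>i}\<close> and \<open>\<psi>\<^sub>i x = (\<bar>x\<bar>\<^sup>2 - \<phi>\<^sub>i x) / 2\<close>; the latter is a maximum of
  finitely many affine functions with slopes in \<open>S\<^sub>i\<close>, hence convex. Weak Kantorovich duality
  (\<open>W2_sq_ge_dual_value\<close>) bounds each \<open>W\<^sub>2\<^sup>2\<close> below by \<open>\<integral>\<phi>\<^sub>i dPbar + \<integral>u\<^sub>i dP\<^sub>i\<close>. By feasibility and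
  Huygens' identity, \<open>\<Sum>i. \<phi>\<^sub>i x \<ge> N * \<bar>x - avg s\<bar>\<^sup>2 \<ge> 0\<close> for every \<open>s\<close> whose components attain the minima
  at \<open>x\<close>. For a barycenter the sum of the lower bounds is therefore attained, and \<open>\<Sum>i. \<phi>\<^sub>i\<close>
  has integral 0. Being continuous and nonnegative it vanishes on the support, which is (iv), and
  there every minimising \<open>s\<close> has mean \<open>x\<close>. Varying one component of \<open>s\<close> shows that the
  minimisers are unique, so \<open>\<psi>\<^sub>i\<close> is affine near \<open>x\<close> with gradient \<open>s\<^sub>i\<close>, which is (iii); the support is
  contained in the finite set of means. Finally each \<open>u\<^sub>i\<close> is an optimal potential between the
  barycenter and \<open>P\<^sub>i\<close>, and complementary slackness (\<open>push_forward_of_optimal_potential\<close>,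
  \<open>cost_of_optimal_potential\<close>) identifies \<open>\<nabla>\<psi>\<^sub>i\<close> as an optimal transport map, which is (i) and (ii).
\<close>

section \<open>Finite linear programming duality\<close>

text \<open>Stated for functions on an arbitrary coordinate type, so that the number of variables of a
  linear programme can depend on the data of a theorem.\<close>

definition lin_fun :: "(('k \<Rightarrow> real) \<Rightarrow> real) \<Rightarrow> bool" where
  "lin_fun f \<longleftrightarrow> (\<forall>x y c. f (\<lambda>k. x k + c * y k) = f x + c * f y)"

lemma lin_funD: "lin_fun f \<Longrightarrow> f (\<lambda>k. x k + c * y k) = f x + c * f y"
  by (auto simp: lin_fun_def)

lemma lin_fun_zero: "lin_fun f \<Longrightarrow> f (\<lambda>k. 0) = 0"
  using lin_funD[of f "\<lambda>k. 0" 1 "\<lambda>k. 0"] by simp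

lemma lin_fun_scale: "lin_fun f \<Longrightarrow> f (\<lambda>k. c * x k) = c * f x"
  using lin_funD[of f "\<lambda>k. 0" c x] lin_fun_zero[of f] by simp

lemma lin_fun_diff_scaled:
  "lin_fun f \<Longrightarrow> lin_fun g \<Longrightarrow> lin_fun (\<lambda>x. f x - a * g x)"
  by (simp add: lin_fun_def algebra_simps)

text \<open>Farkas' lemma by the purely algebraic induction of Bartl, on the number of functionals. If dropping \<open>\<alpha> m\<close> breaks the implication, some \<open>w\<close> with \<open>\<alpha> m w = 1\<close> witnesses
  this. Subtracting multiples of \<open>\<alpha> m\<close> so that all functionals vanish at \<open>w\<close> brings back the
  implication for one functional fewer, and the sign conditions at \<open>w\<close> make the coefficient of
  \<open>\<alpha> m\<close> nonnegative.\<close>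

lemma farkas:
  fixes \<alpha> :: "'j \<Rightarrow> ('k \<Rightarrow> real) \<Rightarrow> real"
  assumes "finite J" "\<And>j. j \<in> J \<Longrightarrow> lin_fun (\<alpha> j)" "lin_fun \<gamma>"
    and "\<And>x. (\<And>j. j \<in> J \<Longrightarrow> \<alpha> j x \<le> 0) \<Longrightarrow> \<gamma> x \<le> 0"
  shows "\<exists>l. (\<forall>j\<in>J. 0 \<le> l j) \<and> (\<forall>x. \<gamma> x = (\<Sum>j\<in>J. l j * \<alpha> j x))"
  using assms
proof (induction J arbitrary: \<alpha> \<gamma> rule: finite_induct)
  case empty
  have "\<gamma> x = 0" for x
    using empty.prems(3)[of x] empty.prems(3)[of "\<lambda>k. -1 * x k"]
      lin_fun_scale[OF empty.prems(2), of "-1" x] by simp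
  then show ?case by simp
next
  case (insert m J)
  note lin = insert.prems(1) and lin\<gamma> = insert.prems(2)
  show ?case
  proof (cases "\<forall>x. (\<forall>j\<in>J. \<alpha> j x \<le> 0) \<longrightarrow> \<gamma> x \<le> 0")
    case True
    then obtain l where "\<forall>j\<in>J. 0 \<le> l j" "\<forall>x. \<gamma> x = (\<Sum>j\<in>J. l j * \<alpha> j x)"
      using insert.IH[of \<alpha> \<gamma>] lin lin\<gamma> by blast
    then have "\<forall>j\<in>insert m J. 0 \<le> (l(m := 0)) j"
      "\<forall>x. \<gamma> x = (\<Sum>j\<in>insert m J. (l(m := 0)) j * \<alpha> j x)"
      using insert.hyps by (auto intro!: sum.cong)
    then show ?thesis by blast
  next
    case False
    then obtain z where z: "\<And>j. j \<in> J \<Longrightarrow> \<alpha> j z \<le> 0" "\<gamma> z > 0"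
      by (auto simp: not_le)
    have m: "\<alpha> m z > 0"
      using insert.prems(3)[of z] z by force
    define w where "w = (\<lambda>k. (1 / \<alpha> m z) * z k)"
    have wsc: "f w = f z / \<alpha> m z" if "lin_fun f" for f
      using lin_fun_scale[OF that, of "1 / \<alpha> m z" z] by (simp add: w_def)
    have w: "\<And>j. j \<in> J \<Longrightarrow> \<alpha> j w \<le> 0" "\<gamma> w > 0" "\<alpha> m w = 1"
      using z m lin lin\<gamma> by (auto simp: wsc divide_nonpos_pos)
    \<comment> \<open>Compose all functionals with the projection along \<open>w\<close> onto the kernel of \<open>\<alpha> m\<close>.\<close>
    define \<alpha>' where "\<alpha>' = (\<lambda>j x. \<alpha> j x - \<alpha> j w * \<alpha> m x)"
    define \<gamma>' where "\<gamma>' = (\<lambda>x. \<gamma> x - \<gamma> w * \<alpha> m x)"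
    have pr: "f (\<lambda>k. x k + (- \<alpha> m x) * w k) = f x - f w * \<alpha> m x" if "lin_fun f" for f x
      using lin_funD[OF that, of x "- \<alpha> m x" w] by simp
    have "\<exists>l. (\<forall>j\<in>J. 0 \<le> l j) \<and> (\<forall>x. \<gamma>' x = (\<Sum>j\<in>J. l j * \<alpha>' j x))"
    proof (rule insert.IH)
      show "lin_fun (\<alpha>' j)" if "j \<in> J" for j
        unfolding \<alpha>'_def using lin that by (intro lin_fun_diff_scaled) auto
      show "lin_fun \<gamma>'"
        unfolding \<gamma>'_def using lin lin\<gamma> by (intro lin_fun_diff_scaled) auto
      show "\<gamma>' x \<le> 0" if x: "\<And>j. j \<in> J \<Longrightarrow> \<alpha>' j x \<le> 0" for x
      proof -
        let ?y = "\<lambda>k. x k + (- \<alpha> m x) * w k"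
        have "\<gamma> ?y \<le> 0"
        proof (rule insert.prems(3))
          fix j assume j: "j \<in> insert m J"
          show "\<alpha> j ?y \<le> 0"
            using x[of j] w(3) j lin pr[of "\<alpha> j" x] by (auto simp: \<alpha>'_def)
        qed
        then show ?thesis using pr[OF lin\<gamma>, of x] by (simp add: \<gamma>'_def)
      qed
    qed
    then obtain l where l: "\<And>j. j \<in> J \<Longrightarrow> 0 \<le> l j" "\<And>x. \<gamma>' x = (\<Sum>j\<in>J. l j * \<alpha>' j x)"
      by blast
    define b where "b = \<gamma> w - (\<Sum>j\<in>J. l j * \<alpha> j w)"
    have "(\<Sum>j\<in>J. l j * \<alpha> j w) \<le> 0"
      using l(1) w(1) by (intro sum_nonpos mult_nonneg_nonpos) auto
    then have b: "b \<ge> 0" using w(2) by (simp add: b_def)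
    have eq: "\<gamma> x = (\<Sum>j\<in>insert m J. (l(m := b)) j * \<alpha> j x)" for x
    proof -
      have "(\<Sum>j\<in>insert m J. (l(m := b)) j * \<alpha> j x) = b * \<alpha> m x + (\<Sum>j\<in>J. l j * \<alpha> j x)"
        using insert.hyps by (auto intro!: sum.cong)
      moreover have "\<gamma> x - \<gamma> w * \<alpha> m x
          = (\<Sum>j\<in>J. l j * \<alpha> j x) - (\<Sum>j\<in>J. l j * \<alpha> j w) * \<alpha> m x"
        using l(2)[of x]
        by (simp add: \<gamma>'_def \<alpha>'_def algebra_simps sum_subtractf sum_distrib_left sum_distrib_right)
      ultimately show ?thesis by (simp add: b_def algebra_simps)
    qed
    have "\<forall>j\<in>insert m J. 0 \<le> (l(m := b)) j" using l(1) b by auto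
    then show ?thesis using eq by blast
  qed
qed

text \<open>Strong duality for the finite multi-marginal transport problem with cost \<open>c\<close>, in the form in
  which any lower bound \<open>V\<close> for the primal is reached by some dual feasible \<open>u\<close>. If no \<open>u\<close> worked,
  Farkas' lemma would express the homogenising coordinate by the dual constraints. The coefficients
  of that expression form, after normalisation by \<open>\<mu>\<close>, a transport plan of cost less than \<open>V\<close>; and
  \<open>\<mu> = 0\<close> is impossible because then the plan and its cost vanish.\<close>

lemma multimarginal_duality:
  fixes I :: "'i set" and S :: "'i \<Rightarrow> 'a set" and p :: "'i \<Rightarrow> 'a \<Rightarrow> real"
  assumes "finite I" "I \<noteq> {}" "\<And>i. i \<in> I \<Longrightarrow> finite (S i)"
    and lower: "\<And>\<pi>. (\<And>s. s \<in> Pi\<^sub>E I S \<Longrightarrow> 0 \<le> \<pi> s) \<Longrightarrow>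
      (\<And>i y. i \<in> I \<Longrightarrow> y \<in> S i \<Longrightarrow> (\<Sum>s | s \<in> Pi\<^sub>E I S \<and> s i = y. \<pi> s) = p i y) \<Longrightarrow>
      V \<le> (\<Sum>s\<in>Pi\<^sub>E I S. \<pi> s * c s)"
  shows "\<exists>u. (\<forall>s\<in>Pi\<^sub>E I S. (\<Sum>i\<in>I. u i (s i)) \<le> c s) \<and>
      V \<le> (\<Sum>i\<in>I. \<Sum>y\<in>S i. u i y * p i y)"
proof (rule ccontr)
  assume contra: "\<not> ?thesis"
  let ?A = "Pi\<^sub>E I S"
  have finA: "finite ?A" using assms by (intro finite_PiE) auto
  \<comment> \<open>The coordinate \<open>None\<close> homogenises the inequalities; the coordinates \<open>Some (i, y)\<close> are the
    dual variables.\<close>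
  define \<alpha> where "\<alpha> = (\<lambda>j (x :: ('i \<times> 'a) option \<Rightarrow> real).
    case j of Some s \<Rightarrow> (\<Sum>i\<in>I. x (Some (i, s i))) - c s * x None
    | None \<Rightarrow> V * x None - (\<Sum>i\<in>I. \<Sum>y\<in>S i. x (Some (i, y)) * p i y))"
  define J where "J = insert None (Some ` ?A)"
  have "\<exists>l. (\<forall>j\<in>J. 0 \<le> l j) \<and> (\<forall>x. x None = (\<Sum>j\<in>J. l j * \<alpha> j x))"
  proof (rule farkas)
    show "finite J" using finA by (simp add: J_def)
    show "lin_fun (\<lambda>x. x None)" by (simp add: lin_fun_def)
    show "lin_fun (\<alpha> j)" for j
      by (cases j) (simp_all add: lin_fun_def \<alpha>_def sum.distrib sum_distrib_left algebra_simps)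
    show "x None \<le> 0" if x: "\<And>j. j \<in> J \<Longrightarrow> \<alpha> j x \<le> 0" for x
    proof (rule ccontr)
      assume "\<not> x None \<le> 0"
      then have t: "x None > 0" by simp
      define u where "u = (\<lambda>i y. x (Some (i, y)) / x None)"
      have "(\<Sum>i\<in>I. u i (s i)) \<le> c s" if "s \<in> ?A" for s
        using x[of "Some s"] that t
        by (simp add: J_def \<alpha>_def u_def field_simps flip: sum_divide_distrib)
      moreover have "V \<le> (\<Sum>i\<in>I. \<Sum>y\<in>S i. u i y * p i y)"
        using x[of None] t
        by (simp add: J_def \<alpha>_def u_def field_simps flip: sum_divide_distrib)
      ultimately show False using contra by blast
    qed
  qed
  then obtain l where l: "\<And>j. j \<in> J \<Longrightarrow> 0 \<le> l j"
    and eq: "\<And>x. x None = (\<Sum>j\<in>J. l j * \<alpha> j x)" by blast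
  define \<pi> where "\<pi> = (\<lambda>s. l (Some s))"
  define \<mu> where "\<mu> = l None"
  have \<pi>0: "0 \<le> \<pi> s" if "s \<in> ?A" for s using l that by (auto simp: \<pi>_def J_def)
  have \<mu>0: "0 \<le> \<mu>" using l by (auto simp: \<mu>_def J_def)
  have eq': "x None = \<mu> * \<alpha> None x + (\<Sum>s\<in>?A. \<pi> s * \<alpha> (Some s) x)" for x
    using eq[of x] finA by (simp add: J_def \<pi>_def \<mu>_def sum.reindex)
  have marg: "(\<Sum>s | s \<in> ?A \<and> s i = y. \<pi> s) = \<mu> * p i y" if iy: "i \<in> I" "y \<in> S i" for i y
  proof -
    define x where "x = (\<lambda>k. if k = Some (i, y) then 1 else 0 :: real)"
    have x0: "x None = 0" by (simp add: x_def)
    have 1: "(\<Sum>i'\<in>I. x (Some (i', s i'))) = of_bool (s i = y)" for s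
    proof -
      have "(\<Sum>i'\<in>I. x (Some (i', s i'))) = (\<Sum>i'\<in>I. if i' = i then of_bool (s i = y) else 0)"
        by (intro sum.cong) (auto simp: x_def)
      then show ?thesis using iy assms(1) by simp
    qed
    have 2: "(\<Sum>i'\<in>I. \<Sum>y'\<in>S i'. x (Some (i', y')) * p i' y') = p i y"
    proof -
      have "(\<Sum>y'\<in>S i'. x (Some (i', y')) * p i' y') = (if i' = i then p i y else 0)"
        if "i' \<in> I" for i'
      proof (cases "i' = i")
        case True
        have "(\<Sum>y'\<in>S i'. x (Some (i', y')) * p i' y') = (\<Sum>y'\<in>S i'. if y' = y then p i y else 0)"
          using True by (intro sum.cong) (auto simp: x_def)
        then show ?thesis using True iy assms(3)[of i] by simp
      qed (simp add: x_def)
      then have "(\<Sum>i'\<in>I. \<Sum>y'\<in>S i'. x (Some (i', y')) * p i' y') = (\<Sum>i'\<in>I. if i' = i then p i y else 0)"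
        by (intro sum.cong) (auto simp: x_def)
      then show ?thesis using iy assms(1) by simp
    qed
    \<comment> \<open>Compare the coefficients of one dual variable.\<close>
    have "0 = - \<mu> * p i y + (\<Sum>s\<in>?A. \<pi> s * of_bool (s i = y))"
      using eq'[of x] by (simp add: \<alpha>_def 1 2 x0)
    also have "(\<Sum>s\<in>?A. \<pi> s * of_bool (s i = y)) = (\<Sum>s | s \<in> ?A \<and> s i = y. \<pi> s)"
      using finA by (intro sum.mono_neutral_cong_right) auto
    finally show ?thesis by simp
  qed
  \<comment> \<open>Compare the coefficients of the homogenising coordinate.\<close>
  have cost: "1 = \<mu> * V - (\<Sum>s\<in>?A. \<pi> s * c s)"
    using eq'[of "\<lambda>k. if k = None then 1 else 0"] by (simp add: \<alpha>_def sum_negf)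
  show False
  proof (cases "\<mu> = 0")
    case True
    obtain i where i: "i \<in> I" using assms(2) by blast
    have "\<pi> s = 0" if s: "s \<in> ?A" for s
    proof -
      have "(\<Sum>s' | s' \<in> ?A \<and> s' i = s i. \<pi> s') = 0"
        using marg[OF i, of "s i"] s i True by auto
      then have "\<forall>s'\<in>{s'. s' \<in> ?A \<and> s' i = s i}. \<pi> s' = 0"
        by (subst (asm) sum_nonneg_eq_0_iff) (use finA \<pi>0 in auto)
      then show ?thesis using s by auto
    qed
    then show False using cost True by simp
  next
    case False
    then have \<mu>: "\<mu> > 0" using \<mu>0 by simp
    have "V \<le> (\<Sum>s\<in>?A. (\<pi> s / \<mu>) * c s)"
    proof (rule lower)
      show "0 \<le> \<pi> s / \<mu>" if "s \<in> ?A" for s using \<pi>0 that \<mu> by simp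
      show "(\<Sum>s | s \<in> ?A \<and> s i = y. \<pi> s / \<mu>) = p i y" if "i \<in> I" "y \<in> S i" for i y
        using marg[OF that] \<mu> by (simp flip: sum_divide_distrib)
    qed
    then have "\<mu> * V \<le> (\<Sum>s\<in>?A. \<pi> s * c s)"
      using \<mu> by (simp add: field_simps flip: sum_divide_distrib)
    then show False using cost by simp
  qed
qed

section \<open>Supports of probability measures\<close>

lemma borel_probD:
  assumes "borel_prob P"
  shows "prob_space P" "sets P = sets borel" "space P = UNIV"
  using assms by (auto simp: borel_prob_def dest: sets_eq_imp_space_eq)

text \<open>The complement of the support is a union of open null sets, and by Lindelof countably many of
  them suffice.\<close>

lemma AE_supp:
  assumes "borel_prob P"
  shows "AE x in P. x \<in> supp P"
proof -
  define F where "F = {U :: 'a set. open U \<and> emeasure P U = 0}"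
  obtain F' where F': "F' \<subseteq> F" "countable F'" "\<Union>F' = \<Union>F"
    by (rule Lindelof[of F]) (auto simp: F_def)
  have "(\<Union>U\<in>F'. U) \<in> null_sets P"
  proof (intro null_sets_UN' F'(2))
    fix U assume "U \<in> F'"
    then have "open U" "emeasure P U = 0" using F'(1) by (auto simp: F_def)
    then show "U \<in> null_sets P"
      using borel_open[of U] borel_probD(2)[OF assms] by (intro null_setsI) auto
  qed
  moreover have "\<Union>F = - supp P" by (auto simp: F_def supp_def not_gr_zero)
  ultimately show ?thesis
    using F' by (intro AE_I'[of "- supp P"]) auto
qed

lemma supp_nonempty:
  assumes "borel_prob P" shows "supp P \<noteq> {}"
proof
  interpret prob_space P using borel_probD[OF assms] by simp
  assume "supp P = {}"
  then have "AE x in P. False" using AE_supp[OF assms] by simp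
  then show False by simp
qed

text \<open>Turns the almost sure vanishing of a continuous function into vanishing at every point of the
  support.\<close>

lemma supp_subset_closed:
  assumes P: "borel_prob P" and C: "closed C" and ae: "AE x in P. x \<in> C"
  shows "supp P \<subseteq> C"
proof (rule subsetI, rule ccontr)
  fix x assume x: "x \<in> supp P" "x \<notin> C"
  have op: "open (- C)" using C by (rule open_Compl)
  then have "- C \<in> sets P" using borel_probD(2)[OF P] by simp
  then have "- C \<in> null_sets P" using ae by (simp add: AE_iff_null_sets)
  moreover have "0 < emeasure P (- C)" using x op by (auto simp: supp_def)
  ultimately show False by auto
qed

text \<open>A measure with finite support is the sum of its atoms, since it lives on its support.\<close>

lemma integral_finite_supp:
  fixes f :: "'a::euclidean_space \<Rightarrow> real"
  assumes P: "discrete_prob P" and f: "f \<in> borel_measurable borel"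
  shows "integrable P f" "(\<integral>x. f x \<partial>P) = (\<Sum>y\<in>supp P. f y * measure P {y})"
proof -
  have bp: "borel_prob P" and fin: "finite (supp P)" using P by (auto simp: discrete_prob_def)
  note bpD = borel_probD[OF bp]
  interpret prob_space P by fact
  have [measurable_cong]: "sets P = sets borel" by fact
  note f [measurable]
  let ?g = "\<lambda>x. \<Sum>y\<in>supp P. f y * indicator {y} x"
  have ae: "AE x in P. f x = ?g x"
    using AE_supp[OF bp]
  proof eventually_elim
    case (elim x)
    have "?g x = (\<Sum>y\<in>supp P. if y = x then f x else 0)"
      by (intro sum.cong) auto
    then show ?case using elim fin by simp
  qed
  have int: "has_bochner_integral P ?g (\<Sum>y\<in>supp P. f y * measure P {y})"
    by (intro has_bochner_integral_sum has_bochner_integral_mult_right has_bochner_integral_real_indicator)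
       (auto simp: bpD less_top[symmetric])
  then have "has_bochner_integral P f (\<Sum>y\<in>supp P. f y * measure P {y})"
    using ae by (subst has_bochner_integral_cong_AE[where g = ?g]) auto
  then show "integrable P f" "(\<integral>x. f x \<partial>P) = (\<Sum>y\<in>supp P. f y * measure P {y})"
    by (auto simp: has_bochner_integral_iff)
qed

section \<open>Maxima of finitely many affine functions\<close>

text \<open>The convex conjugate of \<open>h\<close> restricted to \<open>S\<close>: the largest of the affine functions of slope
  \<open>y \<in> S\<close> and intercept \<open>- h y\<close>. All the \<open>\<psi>\<^sub>i\<close> are of this form.\<close>

definition max_affine :: "'a::euclidean_space set \<Rightarrow> ('a \<Rightarrow> real) \<Rightarrow> 'a \<Rightarrow> real" where
  "max_affine S h x = Max ((\<lambda>y. x \<bullet> y - h y) ` S)"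

text \<open>The open Laguerre cell of \<open>y\<close>, where the affine function of slope \<open>y\<close> is the unique largest one.\<close>

definition laguerre_cell :: "'a::euclidean_space set \<Rightarrow> ('a \<Rightarrow> real) \<Rightarrow> 'a \<Rightarrow> 'a set" where
  "laguerre_cell S h y = {x. \<forall>z\<in>S - {y}. x \<bullet> z - h z < x \<bullet> y - h y}"

context
  fixes S :: "'a::euclidean_space set" and h :: "'a \<Rightarrow> real"
  assumes fin: "finite S" and ne: "S \<noteq> {}"
begin

lemma max_affine_ge: "y \<in> S \<Longrightarrow> x \<bullet> y - h y \<le> max_affine S h x"
  unfolding max_affine_def using fin by (intro Max_ge) auto

lemma max_affine_attained:
  obtains y where "y \<in> S" "max_affine S h x = x \<bullet> y - h y"
proof -
  have "max_affine S h x \<in> (\<lambda>y. x \<bullet> y - h y) ` S"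
    unfolding max_affine_def using fin ne by (intro Max_in) auto
  then show ?thesis using that by auto
qed

lemma convex_on_max_affine: "convex_on UNIV (max_affine S h)"
proof (rule convex_onI)
  fix t :: real and x z :: 'a
  assume t: "0 < t" "t < 1"
  obtain y where y: "y \<in> S" "max_affine S h ((1 - t) *\<^sub>R x + t *\<^sub>R z) = ((1 - t) *\<^sub>R x + t *\<^sub>R z) \<bullet> y - h y"
    using max_affine_attained by blast
  have "((1 - t) *\<^sub>R x + t *\<^sub>R z) \<bullet> y - h y = (1 - t) * (x \<bullet> y - h y) + t * (z \<bullet> y - h y)"
    by (simp add: inner_add_left algebra_simps)
  also have "\<dots> \<le> (1 - t) * max_affine S h x + t * max_affine S h z"
    using t y(1) by (intro add_mono mult_left_mono max_affine_ge) auto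
  finally show "max_affine S h ((1 - t) *\<^sub>R x + t *\<^sub>R z) \<le> (1 - t) * max_affine S h x + t * max_affine S h z"
    using y by simp
qed simp

lemma continuous_on_max_affine: "continuous_on UNIV (max_affine S h)"
  by (intro convex_on_continuous convex_on_max_affine) auto

lemma open_cell: "open (laguerre_cell S h y)"
proof -
  have "laguerre_cell S h y = (\<Inter>z\<in>S - {y}. {x. x \<bullet> z - h z < x \<bullet> y - h y})"
    by (auto simp: laguerre_cell_def)
  then show ?thesis
    using fin by (auto intro!: open_INT open_Collect_less continuous_intros)
qed

lemma max_affine_on_cell: "y \<in> S \<Longrightarrow> x \<in> laguerre_cell S h y \<Longrightarrow> max_affine S h x = x \<bullet> y - h y"
  unfolding max_affine_def using fin
  by (intro Max_eqI) (auto simp: laguerre_cell_def intro: less_imp_le)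

lemma gderiv_max_affine_cell:
  assumes "y \<in> S" "x \<in> laguerre_cell S h y"
  shows "GDERIV (max_affine S h) x :> y"
proof -
  have "((\<lambda>x. x \<bullet> y - h y) has_derivative (\<lambda>v. v \<bullet> y)) (at x)"
    by (auto intro!: derivative_eq_intros)
  then have "(max_affine S h has_derivative (\<lambda>v. v \<bullet> y)) (at x)"
    by (rule has_derivative_transform_within_open[OF _ open_cell[of y]])
       (use assms max_affine_on_cell in auto)
  then show ?thesis by (simp add: gderiv_def)
qed

text \<open>An affine function that touches \<open>max_affine S h\<close> from below at \<open>x\<close> has the same gradient there, because
  the difference has a minimum at \<open>x\<close>. Hence the gradient fails to exist wherever two slopes are
  active.\<close>

lemma gderiv_max_affine_active:
  assumes D: "GDERIV (max_affine S h) x :> v" and y: "y \<in> S" "max_affine S h x = x \<bullet> y - h y"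
  shows "v = y"
proof -
  have "((\<lambda>z. max_affine S h z - (z \<bullet> y - h y)) has_derivative (\<lambda>w. w \<bullet> v - w \<bullet> y)) (at x)"
    using D by (auto intro!: derivative_eq_intros simp: gderiv_def)
  then have "(\<lambda>w. w \<bullet> v - w \<bullet> y) = (\<lambda>w. 0)"
    using y(2) max_affine_ge[OF y(1)] by (intro differential_zero_maxmin[of x UNIV]) auto
  then have "(v - y) \<bullet> v - (v - y) \<bullet> y = 0" by meson
  then show ?thesis by (simp flip: inner_diff_right)
qed

lemma grad_max_affine_cell:
  assumes "y \<in> S" "x \<in> laguerre_cell S h y"
  shows "grad (max_affine S h) x = y"
  unfolding grad_def
  using gderiv_max_affine_cell[OF assms] gderiv_max_affine_active[OF _ assms(1)] max_affine_on_cell[OF assms]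
  by (intro the_equality) auto

lemma max_affine_differentiable_cell:
  assumes "y \<in> S" "x \<in> laguerre_cell S h y"
  shows "max_affine S h differentiable (at x)"
  using gderiv_max_affine_cell[OF assms] by (auto simp: gderiv_def differentiable_def)

lemma not_gderiv_outside_cells:
  assumes "x \<notin> (\<Union>y\<in>S. laguerre_cell S h y)"
  shows "\<not> GDERIV (max_affine S h) x :> v"
proof
  assume D: "GDERIV (max_affine S h) x :> v"
  obtain y where y: "y \<in> S" "max_affine S h x = x \<bullet> y - h y" using max_affine_attained by blast
  from assms y obtain z where z: "z \<in> S" "z \<noteq> y" "x \<bullet> y - h y \<le> x \<bullet> z - h z"
    by (auto simp: laguerre_cell_def not_less)
  then have "max_affine S h x = x \<bullet> z - h z" using y max_affine_ge[of z x] by linarith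
  then show False using gderiv_max_affine_active[OF D] y z by metis
qed

text \<open>The push-forward under the gradient is meaningful only if the gradient is measurable on the whole
  space. On the finitely many open cells it is constant, and on the remaining closed set it takes
  the default value of \<open>grad\<close>.\<close>

lemma borel_measurable_grad_max_affine: "grad (max_affine S h) \<in> borel_measurable borel"
proof (rule measurableI)
  fix A :: "'a set" assume "A \<in> sets borel"
  \<comment> \<open>The value of \<open>grad\<close> where no gradient exists.\<close>
  define d where "d = (THE v :: 'a. False)"
  have out: "grad (max_affine S h) x = d" if "x \<notin> (\<Union>y\<in>S. laguerre_cell S h y)" for x
    using not_gderiv_outside_cells[OF that] by (simp add: grad_def d_def)
  have "grad (max_affine S h) -` A =
      (\<Union>y\<in>S \<inter> A. laguerre_cell S h y) \<union> (if d \<in> A then - (\<Union>y\<in>S. laguerre_cell S h y) else {})" (is "?L = ?R")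
  proof (rule set_eqI)
    fix x
    show "x \<in> ?L \<longleftrightarrow> x \<in> ?R"
    proof (cases "x \<in> (\<Union>y\<in>S. laguerre_cell S h y)")
      case True
      then obtain y where y: "y \<in> S" "x \<in> laguerre_cell S h y" by blast
      have uniq: "z = y" if "z \<in> S" "x \<in> laguerre_cell S h z" for z
        using grad_max_affine_cell[OF y] grad_max_affine_cell[OF that] by simp
      have "x \<in> ?L \<longleftrightarrow> y \<in> A" using grad_max_affine_cell[OF y] by simp
      moreover have "x \<in> (\<Union>y\<in>S \<inter> A. laguerre_cell S h y) \<longleftrightarrow> y \<in> A"
        using y uniq by blast
      moreover have "x \<notin> (if d \<in> A then - (\<Union>y\<in>S. laguerre_cell S h y) else {})"
        using True by (metis ComplD empty_iff)
      ultimately show ?thesis by blast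
    next
      case False
      have "x \<in> ?L \<longleftrightarrow> d \<in> A" using out[OF False] by simp
      moreover have "x \<in> (if d \<in> A then - (\<Union>y\<in>S. laguerre_cell S h y) else {}) \<longleftrightarrow> d \<in> A"
        using False by (metis ComplI empty_iff)
      moreover have "x \<notin> (\<Union>y\<in>S \<inter> A. laguerre_cell S h y)"
        using False by blast
      ultimately show ?thesis by blast
    qed
  qed
  moreover have "?R \<in> sets borel"
  proof (rule sets.Un)
    show "(\<Union>y\<in>S \<inter> A. laguerre_cell S h y) \<in> sets borel"
      using open_cell by (intro borel_open open_UN) blast
    have "closed (- (\<Union>y\<in>S. laguerre_cell S h y))"
      using open_cell by (intro closed_Compl open_UN) blast
    then show "(if d \<in> A then - (\<Union>y\<in>S. laguerre_cell S h y) else {}) \<in> sets borel"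
      by (simp add: borel_closed del: Compl_UN)
  qed
  ultimately show "grad (max_affine S h) -` A \<inter> space borel \<in> sets borel" by simp
qed simp

end

section \<open>Couplings and the quadratic Wasserstein distance\<close>

lemma W2_sq_eq:
  "(W2 P Q)\<^sup>2 = enn2real (INF \<gamma>\<in>couplings P Q. \<integral>\<^sup>+z. ennreal ((norm (fst z - snd z))\<^sup>2) \<partial>\<gamma>)"
  by (simp add: W2_def)

lemma P2_D:
  assumes "P \<in> P2"
  shows "borel_prob P" "integrable P (\<lambda>x. (norm x)\<^sup>2)"
proof -
  show bp: "borel_prob P" using assms by (simp add: P2_def)
  have [measurable_cong]: "sets P = sets borel" using borel_probD[OF bp] by simp
  show "integrable P (\<lambda>x. (norm x)\<^sup>2)"
    using assms by (intro integrableI_bounded) (auto simp: P2_def)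
qed

lemma P2_I:
  assumes "borel_prob P" "integrable P (\<lambda>x. (norm x)\<^sup>2)"
  shows "P \<in> P2"
  using assms by (auto simp: P2_def integrable_iff_bounded)

lemma discrete_prob_P2: "discrete_prob P \<Longrightarrow> P \<in> P2"
  by (intro P2_I integral_finite_supp) (auto simp: discrete_prob_def)

lemma couplings_nonempty:
  assumes P: "borel_prob P" and Q: "borel_prob Q"
  shows "couplings P Q \<noteq> {}"
proof -
  interpret P: prob_space P using borel_probD[OF P] by simp
  interpret Q: prob_space Q using borel_probD[OF Q] by simp
  interpret PQ: pair_prob_space P Q ..
  have s: "sets P = sets borel" "sets Q = sets borel" "space P = UNIV" "space Q = UNIV"
    using borel_probD[OF P] borel_probD[OF Q] by auto
  have sp: "sets (P \<Otimes>\<^sub>M Q) = sets (borel \<Otimes>\<^sub>M borel)"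
    using s by (intro sets_pair_measure_cong)
  have "distr (P \<Otimes>\<^sub>M Q) borel fst = P"
  proof (rule measure_eqI)
    fix A :: "'a set" assume A: "A \<in> sets (distr (P \<Otimes>\<^sub>M Q) borel fst)"
    have "emeasure (distr (P \<Otimes>\<^sub>M Q) borel fst) A = emeasure (P \<Otimes>\<^sub>M Q) (fst -` A \<inter> space (P \<Otimes>\<^sub>M Q))"
      using A s by (intro emeasure_distr) (auto intro: measurable_fst' simp: measurable_cong_sets[OF sp refl])
    also have "fst -` A \<inter> space (P \<Otimes>\<^sub>M Q) = A \<times> UNIV"
      using s by (auto simp: space_pair_measure)
    finally show "emeasure (distr (P \<Otimes>\<^sub>M Q) borel fst) A = emeasure P A"
      using A s Q.emeasure_space_1 by (simp add: Q.emeasure_pair_measure_Times)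
  qed (use s in auto)
  moreover have "distr (P \<Otimes>\<^sub>M Q) borel snd = Q"
  proof (rule measure_eqI)
    fix A :: "'a set" assume A: "A \<in> sets (distr (P \<Otimes>\<^sub>M Q) borel snd)"
    have "emeasure (distr (P \<Otimes>\<^sub>M Q) borel snd) A = emeasure (P \<Otimes>\<^sub>M Q) (snd -` A \<inter> space (P \<Otimes>\<^sub>M Q))"
      using A s by (intro emeasure_distr) (auto intro: measurable_snd' simp: measurable_cong_sets[OF sp refl])
    also have "snd -` A \<inter> space (P \<Otimes>\<^sub>M Q) = UNIV \<times> A"
      using s by (auto simp: space_pair_measure)
    finally show "emeasure (distr (P \<Otimes>\<^sub>M Q) borel snd) A = emeasure Q A"
      using A s P.emeasure_space_1 by (simp add: Q.emeasure_pair_measure_Times)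
  qed (use s in auto)
  ultimately have "P \<Otimes>\<^sub>M Q \<in> couplings P Q"
    using sp PQ.prob_space_axioms by (simp add: couplings_def)
  then show ?thesis by blast
qed

context
  fixes P Q :: "'a::euclidean_space measure" and \<gamma> :: "('a \<times> 'a) measure"
  assumes coup: "\<gamma> \<in> couplings P Q"
begin

lemma coupling_prob_space: "prob_space \<gamma>"
  and coupling_sets: "sets \<gamma> = sets (borel \<Otimes>\<^sub>M borel)"
  and coupling_fst: "distr \<gamma> borel fst = P"
  and coupling_snd: "distr \<gamma> borel snd = Q"
  using coup by (auto simp: couplings_def)

lemma coupling_measurable:
  "fst \<in> measurable \<gamma> borel" "snd \<in> measurable \<gamma> borel"
  by (simp_all add: measurable_cong_sets[OF coupling_sets refl])

lemma coupling_AE: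
  "AE x in P. R x \<Longrightarrow> AE z in \<gamma>. R (fst z)"
  "AE y in Q. R y \<Longrightarrow> AE z in \<gamma>. R (snd z)"
proof -
  show "AE z in \<gamma>. R (fst z)" if "AE x in P. R x"
    by (rule AE_distrD[OF coupling_measurable(1)]) (unfold coupling_fst, rule that)
  show "AE z in \<gamma>. R (snd z)" if "AE x in Q. R x"
    by (rule AE_distrD[OF coupling_measurable(2)]) (unfold coupling_snd, rule that)
qed

lemma coupling_integral:
  fixes f :: "'a \<Rightarrow> real"
  assumes "f \<in> borel_measurable borel"
  shows "integrable P f \<Longrightarrow> integrable \<gamma> (\<lambda>z. f (fst z))"
    "(\<integral>z. f (fst z) \<partial>\<gamma>) = (\<integral>x. f x \<partial>P)"
    "integrable Q f \<Longrightarrow> integrable \<gamma> (\<lambda>z. f (snd z))"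
    "(\<integral>z. f (snd z) \<partial>\<gamma>) = (\<integral>x. f x \<partial>Q)"
  using integrable_distr_eq[OF coupling_measurable(1) assms]
    integrable_distr_eq[OF coupling_measurable(2) assms]
    integral_distr[OF coupling_measurable(1) assms]
    integral_distr[OF coupling_measurable(2) assms]
  by (simp_all add: coupling_fst coupling_snd)

lemma coupling_cost_integrable:
  assumes "P \<in> P2" "Q \<in> P2"
  shows "integrable \<gamma> (\<lambda>z. (norm (fst z - snd z))\<^sup>2)"
proof (rule Bochner_Integration.integrable_bound)
  show "integrable \<gamma> (\<lambda>z. 2 * (norm (fst z))\<^sup>2 + 2 * (norm (snd z))\<^sup>2)"
    using P2_D[OF assms(1)] P2_D[OF assms(2)]
    by (intro Bochner_Integration.integrable_add integrable_mult_right coupling_integral) auto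
  show "(\<lambda>z. (norm (fst z - snd z))\<^sup>2) \<in> borel_measurable \<gamma>"
    using coupling_measurable by measurable
  have "(norm (x - y))\<^sup>2 \<le> 2 * (norm x)\<^sup>2 + 2 * (norm y)\<^sup>2" for x y :: 'a
  proof -
    \<comment> \<open>By the parallelogram law this is the claim.\<close>
    have "0 \<le> (norm (x + y))\<^sup>2" by simp
    then show ?thesis
      by (simp add: power2_norm_eq_inner inner_add inner_diff inner_commute algebra_simps)
  qed
  then show "AE z in \<gamma>. norm ((norm (fst z - snd z))\<^sup>2)
      \<le> norm (2 * (norm (fst z))\<^sup>2 + 2 * (norm (snd z))\<^sup>2)"
    by (intro AE_I2) simp
qed

lemma coupling_nn_cost:
  assumes "P \<in> P2" "Q \<in> P2"
  shows "(\<integral>\<^sup>+z. ennreal ((norm (fst z - snd z))\<^sup>2) \<partial>\<gamma>) =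
    ennreal (\<integral>z. (norm (fst z - snd z))\<^sup>2 \<partial>\<gamma>)"
  using coupling_cost_integrable[OF assms] by (intro nn_integral_eq_integral) auto

lemma W2_sq_le:
  assumes "P \<in> P2" "Q \<in> P2"
  shows "(W2 P Q)\<^sup>2 \<le> (\<integral>z. (norm (fst z - snd z))\<^sup>2 \<partial>\<gamma>)"
proof -
  have "(INF \<gamma>\<in>couplings P Q. \<integral>\<^sup>+z. ennreal ((norm (fst z - snd z))\<^sup>2) \<partial>\<gamma>)
      \<le> (\<integral>\<^sup>+z. ennreal ((norm (fst z - snd z))\<^sup>2) \<partial>\<gamma>)"
    by (rule INF_lower[OF coup])
  also have "\<dots> = ennreal (\<integral>z. (norm (fst z - snd z))\<^sup>2 \<partial>\<gamma>)"
    by (rule coupling_nn_cost[OF assms])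
  finally show ?thesis
    unfolding W2_sq_eq by (intro enn2real_leI) auto
qed

end

text \<open>The infimum in \<open>W2\<close> is finite because the product coupling has finite cost; hence it is the
  limit of the costs of near-optimal couplings.\<close>

lemma W2_sq_approx:
  assumes "P \<in> P2" "Q \<in> P2" "0 < e"
  obtains \<gamma> where "\<gamma> \<in> couplings P Q" "(\<integral>z. (norm (fst z - snd z))\<^sup>2 \<partial>\<gamma>) < (W2 P Q)\<^sup>2 + e"
proof -
  let ?C = "\<lambda>\<gamma>. \<integral>\<^sup>+z. ennreal ((norm (fst z - snd z))\<^sup>2) \<partial>\<gamma>"
  let ?I = "INF \<gamma>\<in>couplings P Q. ?C \<gamma>"
  obtain \<gamma>0 where g0: "\<gamma>0 \<in> couplings P Q"
    using couplings_nonempty P2_D assms by blast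
  have "?I \<le> ?C \<gamma>0" by (rule INF_lower[OF g0])
  also have "?C \<gamma>0 = ennreal (\<integral>z. (norm (fst z - snd z))\<^sup>2 \<partial>\<gamma>0)"
    by (rule coupling_nn_cost[OF g0 assms(1,2)])
  also have "\<dots> < \<infinity>" by simp
  finally have "?I < \<infinity>" .
  then have "?I = ennreal ((W2 P Q)\<^sup>2)"
    unfolding W2_sq_eq by (intro ennreal_enn2real[symmetric]) (simp only: infinity_ennreal_def)
  also have "\<dots> < ennreal ((W2 P Q)\<^sup>2 + e)" using assms(3) by (simp add: ennreal_less_iff)
  finally obtain \<gamma> where g: "\<gamma> \<in> couplings P Q" "?C \<gamma> < ennreal ((W2 P Q)\<^sup>2 + e)"
    by (auto simp: INF_less_iff)
  then have "ennreal (\<integral>z. (norm (fst z - snd z))\<^sup>2 \<partial>\<gamma>) < ennreal ((W2 P Q)\<^sup>2 + e)"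
    unfolding coupling_nn_cost[OF g(1) assms(1,2)] by simp
  then show ?thesis
    by (intro that[OF g(1)]) (simp add: ennreal_less_iff del: ennreal_plus)
qed

section \<open>Kantorovich duality for a discrete target\<close>

lemma integrable_max_affine:
  assumes S: "finite S" "S \<noteq> {}" and P: "P \<in> P2"
  shows "integrable P (max_affine S h)"
proof (rule Bochner_Integration.integrable_bound)
  interpret prob_space P using P2_D[OF P] borel_probD by blast
  have sets: "sets P = sets borel" using P2_D[OF P] borel_probD by blast
  show "integrable P (\<lambda>x. \<Sum>y\<in>S. (norm x)\<^sup>2 + (norm y)\<^sup>2 + \<bar>h y\<bar>)"
    using P2_D[OF P] by auto
  show "max_affine S h \<in> borel_measurable P"
    using borel_measurable_continuous_onI[OF continuous_on_max_affine[OF S]] sets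
    by (simp cong: measurable_cong_sets)
  show "AE x in P. norm (max_affine S h x) \<le> norm (\<Sum>y\<in>S. (norm x)\<^sup>2 + (norm y)\<^sup>2 + \<bar>h y\<bar>)"
  proof (rule AE_I2)
    fix x
    obtain y where y: "y \<in> S" "max_affine S h x = x \<bullet> y - h y"
      using max_affine_attained[OF S] by blast
    have "\<bar>x \<bullet> y\<bar> \<le> norm x * norm y" by (rule Cauchy_Schwarz_ineq2)
    also have "\<dots> \<le> (norm x)\<^sup>2 + (norm y)\<^sup>2"
      using sum_squares_bound[of "norm x" "norm y"] zero_le_power2[of "norm x"]
        zero_le_power2[of "norm y"] by linarith
    finally have "\<bar>max_affine S h x\<bar> \<le> (norm x)\<^sup>2 + (norm y)\<^sup>2 + \<bar>h y\<bar>" using y(2) by linarith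
    also have "\<dots> \<le> (\<Sum>y\<in>S. (norm x)\<^sup>2 + (norm y)\<^sup>2 + \<bar>h y\<bar>)"
      using y(1) S(1) by (intro member_le_sum) auto
    finally show "norm (max_affine S h x) \<le> norm (\<Sum>y\<in>S. (norm x)\<^sup>2 + (norm y)\<^sup>2 + \<bar>h y\<bar>)"
      by (simp add: abs_of_nonneg sum_nonneg)
  qed
qed

text \<open>The Kantorovich dual objective, under the substitution that turns \<open>c\<close>-concave potentials for the
  quadratic cost into convex functions: \<open>\<phi> x = \<bar>x\<bar>\<^sup>2 - 2 * max_affine (supp Q) h x\<close> is the
  \<open>c\<close>-transform of \<open>u y = \<bar>y\<bar>\<^sup>2 - 2 * h y\<close>, so that \<open>\<phi> x + u y \<le> \<bar>x - y\<bar>\<^sup>2\<close> for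
  \<open>y \<in> supp Q\<close>.\<close>

definition dual_value where
  "dual_value P Q h = (\<integral>x. (norm x)\<^sup>2 - 2 * max_affine (supp Q) h x \<partial>P) + (\<integral>y. (norm y)\<^sup>2 - 2 * h y \<partial>Q)"

context
  fixes P Q :: "'a::euclidean_space measure" and h :: "'a \<Rightarrow> real"
  assumes P: "P \<in> P2" and Q: "discrete_prob Q" and h: "h \<in> borel_measurable borel"
begin

private lemma suppQ: "finite (supp Q)" "supp Q \<noteq> {}"
  using Q supp_nonempty[of Q] by (auto simp: discrete_prob_def)

text \<open>The excess of the cost of a coupling over the dual value is the integral of twice the pointwise
  gap in Young's inequality for \<open>max_affine (supp Q) h\<close> and \<open>h\<close>. Bounding it below gives weak duality;
  bounding it above confines near-optimal couplings to the contact set.\<close>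

lemma coupling_duality_gap:
  assumes coup: "\<gamma> \<in> couplings P Q"
  defines "gap \<equiv> (\<lambda>z. max_affine (supp Q) h (fst z) + h (snd z) - fst z \<bullet> snd z)"
  shows "integrable \<gamma> gap" "AE z in \<gamma>. 0 \<le> gap z"
    "(\<integral>z. (norm (fst z - snd z))\<^sup>2 \<partial>\<gamma>) = dual_value P Q h + 2 * (\<integral>z. gap z \<partial>\<gamma>)"
proof -
  note Q2 = discrete_prob_P2[OF Q]
  have [measurable]: "max_affine (supp Q) h \<in> borel_measurable borel"
    by (intro borel_measurable_continuous_onI continuous_on_max_affine suppQ)
  note [measurable] = h
  let ?f = "\<lambda>x. (norm x)\<^sup>2 - 2 * max_affine (supp Q) h x" and ?u = "\<lambda>y. (norm y)\<^sup>2 - 2 * h y"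
  let ?c = "\<lambda>z. (norm (fst z - snd z))\<^sup>2"
  have mf: "?f \<in> borel_measurable borel" and mu: "?u \<in> borel_measurable borel" by measurable
  have iu: "integrable Q ?u" by (rule integral_finite_supp(1)[OF Q mu])
  have if_: "integrable P ?f"
    using P2_D[OF P] integrable_max_affine[OF suppQ P] by simp
  have f: "integrable \<gamma> (\<lambda>z. ?f (fst z))" "(\<integral>z. ?f (fst z) \<partial>\<gamma>) = (\<integral>x. ?f x \<partial>P)"
    by (fact coupling_integral(1)[OF coup mf if_] coupling_integral(2)[OF coup mf])+
  have u: "integrable \<gamma> (\<lambda>z. ?u (snd z))" "(\<integral>z. ?u (snd z) \<partial>\<gamma>) = (\<integral>x. ?u x \<partial>Q)"
    by (fact coupling_integral(3)[OF coup mu iu] coupling_integral(4)[OF coup mu])+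
  note c = coupling_cost_integrable[OF coup P Q2]
  have gap: "gap = (\<lambda>z. (?c z - ?f (fst z) - ?u (snd z)) / 2)"
    by (auto simp: gap_def power2_norm_eq_inner inner_diff inner_commute field_simps)
  show "integrable \<gamma> gap" unfolding gap using c f u by simp
  have "(\<integral>z. gap z \<partial>\<gamma>) = (\<integral>z. ?c z - ?f (fst z) - ?u (snd z) \<partial>\<gamma>) / 2"
    unfolding gap by (rule integral_divide_zero)
  also have "(\<integral>z. ?c z - ?f (fst z) - ?u (snd z) \<partial>\<gamma>)
      = (\<integral>z. ?c z - ?f (fst z) \<partial>\<gamma>) - (\<integral>z. ?u (snd z) \<partial>\<gamma>)"
    by (rule Bochner_Integration.integral_diff[OF Bochner_Integration.integrable_diff[OF c f(1)] u(1)])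
  also have "(\<integral>z. ?c z - ?f (fst z) \<partial>\<gamma>) = (\<integral>z. ?c z \<partial>\<gamma>) - (\<integral>z. ?f (fst z) \<partial>\<gamma>)"
    by (rule Bochner_Integration.integral_diff[OF c f(1)])
  finally have "2 * (\<integral>z. gap z \<partial>\<gamma>) = (\<integral>z. ?c z \<partial>\<gamma>) - dual_value P Q h"
    unfolding f(2) u(2) dual_value_def by argo
  then show "(\<integral>z. ?c z \<partial>\<gamma>) = dual_value P Q h + 2 * (\<integral>z. gap z \<partial>\<gamma>)"
    by argo
  have "AE z in \<gamma>. snd z \<in> supp Q"
    using coupling_AE(2)[OF coup] AE_supp[of Q] Q by (auto simp: discrete_prob_def)
  then show "AE z in \<gamma>. 0 \<le> gap z"
  proof eventually_elim
    case (elim z)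
    then show ?case using max_affine_ge[OF suppQ elim, of "fst z" h] by (simp add: gap_def)
  qed
qed

lemma W2_sq_ge_dual_value: "dual_value P Q h \<le> (W2 P Q)\<^sup>2"
proof (rule field_le_epsilon)
  fix e :: real assume "0 < e"
  then obtain \<gamma> where g: "\<gamma> \<in> couplings P Q"
    "(\<integral>z. (norm (fst z - snd z))\<^sup>2 \<partial>\<gamma>) < (W2 P Q)\<^sup>2 + e"
    using W2_sq_approx[OF P discrete_prob_P2[OF Q]] by blast
  have "0 \<le> (\<integral>z. max_affine (supp Q) h (fst z) + h (snd z) - fst z \<bullet> snd z \<partial>\<gamma>)"
    using coupling_duality_gap(2)[OF g(1)] by (intro integral_nonneg_AE)
  then show "dual_value P Q h \<le> (W2 P Q)\<^sup>2 + e"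
    using coupling_duality_gap(3)[OF g(1)] g(2) by linarith
qed

text \<open>Complementary slackness: suppose that \<open>h\<close> is an optimal potential and every point \<open>x\<close> of the finite
  support of \<open>P\<close> lies in a single Laguerre cell, that of \<open>T x\<close>. Then \<open>T\<close> is an optimal transport
  map.\<close>

context
  fixes T :: "'a \<Rightarrow> 'a"
  assumes opt: "(W2 P Q)\<^sup>2 = dual_value P Q h" and fin: "finite (supp P)"
    and T: "T \<in> borel_measurable borel"
    and cell: "\<And>x. x \<in> supp P \<Longrightarrow> T x \<in> supp Q \<and> x \<in> laguerre_cell (supp Q) h (T x)"
begin

text \<open>A coupling of cost almost \<open>W2\<^sup>2\<close> has a small integrated gap. Off the graph of \<open>T\<close> the gap is at least
  some \<open>\<delta> > 0\<close>, since only finitely many pairs of support points are involved, so by Markov's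
  inequality the second component equals \<open>T\<close> of the first with probability close to 1.\<close>

private lemma push_le:
  assumes A: "A \<in> sets borel"
  shows "measure (distr P borel T) A \<le> measure Q A"
proof -
  define g where "g = (\<lambda>z. max_affine (supp Q) h (fst z) + h (snd z) - fst z \<bullet> snd z)"
  define F where "F = {z \<in> supp P \<times> supp Q. snd z \<noteq> T (fst z)}"
  have finF: "finite F" using fin suppQ unfolding F_def by simp
  have gpos: "0 < g z" if zF: "z \<in> F" for z
  proof -
    obtain x y where z: "z = (x, y)" "x \<in> supp P" "y \<in> supp Q" "y \<noteq> T x"
      using zF by (cases z) (auto simp: F_def)
    then have "x \<bullet> y - h y < x \<bullet> T x - h (T x)" using cell[OF z(2)] by (auto simp: laguerre_cell_def)
    moreover have "max_affine (supp Q) h x = x \<bullet> T x - h (T x)"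
      using max_affine_on_cell[OF suppQ] cell[OF z(2)] by blast
    ultimately show ?thesis by (simp add: g_def z)
  qed
  \<comment> \<open>The entry 1 keeps the minimum defined and positive when \<open>F\<close> is empty.\<close>
  define \<delta> where "\<delta> = Min (insert 1 (g ` F))"
  have \<delta>: "0 < \<delta>" "\<And>z. z \<in> F \<Longrightarrow> \<delta> \<le> g z"
    using finF gpos by (auto simp: \<delta>_def)
  have bpP: "borel_prob P" and bpQ: "borel_prob Q"
    using P2_D[OF P] Q by (auto simp: discrete_prob_def)
  note [measurable] = T A
  have "measure (distr P borel T) A \<le> measure Q A + e" if e: "0 < e" for e
  proof -
    obtain \<gamma> where c: "\<gamma> \<in> couplings P Q"
      "(\<integral>z. (norm (fst z - snd z))\<^sup>2 \<partial>\<gamma>) < (W2 P Q)\<^sup>2 + 2 * (\<delta> * e)"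
      using W2_sq_approx[OF P discrete_prob_P2[OF Q], of "2 * (\<delta> * e)"] e \<delta> by auto
    interpret g: prob_space \<gamma> by (rule coupling_prob_space[OF c(1)])
    note [measurable] = coupling_measurable[OF c(1)]
    note gap = coupling_duality_gap[OF c(1), folded g_def]
    have gap_small: "(\<integral>z. g z \<partial>\<gamma>) < \<delta> * e" using gap(3) c(2) opt by simp
    define D where "D = {z \<in> space \<gamma>. snd z \<noteq> T (fst z)}"
    have [measurable]: "D \<in> sets \<gamma>" unfolding D_def by measurable
    have "AE z in \<gamma>. fst z \<in> supp P" "AE z in \<gamma>. snd z \<in> supp Q"
      using coupling_AE[OF c(1)] AE_supp[OF bpP] AE_supp[OF bpQ] by auto
    moreover have "AE z in \<gamma>. 0 \<le> g z" using gap(2) by (simp add: g_def)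
    ultimately have "AE z in \<gamma>. \<delta> * indicator D z \<le> g z"
    proof eventually_elim
      case (elim z)
      then show ?case
        using \<delta>(2)[of z] by (cases z) (auto simp: F_def D_def indicator_def)
    qed
    then have "(\<integral>z. \<delta> * indicator D z \<partial>\<gamma>) \<le> (\<integral>z. g z \<partial>\<gamma>)"
      using gap(1) by (intro integral_mono_AE) (auto simp: less_top[symmetric])
    then have "\<delta> * g.prob D < \<delta> * e" using gap_small by simp
    then have D: "g.prob D < e" using \<delta>(1) by simp
    have "measure (distr P borel T) A = measure \<gamma> {z \<in> space \<gamma>. T (fst z) \<in> A}"
    proof -
      have "distr P borel T = distr \<gamma> borel (\<lambda>z. T (fst z))"
        by (subst coupling_fst[OF c(1), symmetric], subst distr_distr) (auto simp: comp_def)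
      then show ?thesis
        by (simp add: measure_distr vimage_def Int_def conj_commute)
    qed
    also have "\<dots> \<le> measure \<gamma> ({z \<in> space \<gamma>. snd z \<in> A} \<union> D)"
      by (intro g.finite_measure_mono) (auto simp: D_def)
    also have "\<dots> \<le> measure \<gamma> {z \<in> space \<gamma>. snd z \<in> A} + g.prob D"
      by (intro measure_Un_le) auto
    also have "measure \<gamma> {z \<in> space \<gamma>. snd z \<in> A} = measure Q A"
      by (subst coupling_snd[OF c(1), symmetric])
         (simp add: measure_distr vimage_def Int_def conj_commute)
    finally show ?thesis using D by simp
  qed
  then show ?thesis by (rule field_le_epsilon)
qed

lemma push_forward_of_optimal_potential: "distr P borel T = Q"
proof (rule measure_eqI)
  have bpP: "borel_prob P" and bpQ: "borel_prob Q"
    using P2_D[OF P] Q by (auto simp: discrete_prob_def)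
  note D = borel_probD[OF bpP] borel_probD[OF bpQ]
  interpret P: prob_space P by (rule D)
  interpret Q: prob_space Q by (rule D)
  have TP: "T \<in> measurable P borel" using T D by (simp cong: measurable_cong_sets)
  interpret TP: prob_space "distr P borel T" by (rule P.prob_space_distr[OF TP])
  fix A assume "A \<in> sets (distr P borel T)"
  then have A: "A \<in> sets borel" by simp
  \<comment> \<open>An inequality between two probability measures on all sets is an equality: pass to complements.\<close>
  have "1 - TP.prob A \<le> 1 - Q.prob A"
    using push_le[of "- A"] A TP.prob_compl[of A] Q.prob_compl[of A] D by (simp add: Compl_eq_Diff_UNIV)
  then have "TP.prob A = Q.prob A" using push_le[OF A] by simp
  then show "emeasure (distr P borel T) A = emeasure Q A"
    by (simp add: TP.emeasure_eq_measure Q.emeasure_eq_measure)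
qed (use Q in \<open>auto simp: discrete_prob_def borel_prob_def\<close>)

lemma cost_of_optimal_potential: "(\<integral>x. (norm (x - T x))\<^sup>2 \<partial>P) = (W2 P Q)\<^sup>2"
proof -
  have bpP: "borel_prob P" using P2_D[OF P] by simp
  note D = borel_probD[OF bpP]
  have TP: "T \<in> measurable P borel" using T D by (simp cong: measurable_cong_sets)
  have ms: "max_affine (supp Q) h \<in> borel_measurable borel"
    by (intro borel_measurable_continuous_onI continuous_on_max_affine suppQ)
  note [measurable] = h T ms
  have [measurable_cong]: "sets P = sets borel" by (rule D)
  let ?f = "\<lambda>x. (norm x)\<^sup>2 - 2 * max_affine (supp Q) h x" and ?u = "\<lambda>y. (norm y)\<^sup>2 - 2 * h y"
  have "AE x in P. (norm (x - T x))\<^sup>2 = ?f x + ?u (T x)"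
    using AE_supp[OF bpP]
  proof eventually_elim
    case (elim x)
    then show ?case
      using max_affine_on_cell[OF suppQ, of "T x" x h] cell[OF elim]
      by (simp add: power2_norm_eq_inner inner_diff inner_commute algebra_simps)
  qed
  then have "(\<integral>x. (norm (x - T x))\<^sup>2 \<partial>P) = (\<integral>x. ?f x + ?u (T x) \<partial>P)"
    by (intro integral_cong_AE) auto
  also have "\<dots> = (\<integral>x. ?f x \<partial>P) + (\<integral>x. ?u (T x) \<partial>P)"
  proof (rule Bochner_Integration.integral_add)
    show "integrable P ?f" using P2_D[OF P] integrable_max_affine[OF suppQ P] by simp
    have "integrable (distr P borel T) ?u"
      unfolding push_forward_of_optimal_potential by (intro integral_finite_supp Q) auto
    then show "integrable P (\<lambda>x. ?u (T x))"
      by (subst (asm) integrable_distr_eq[OF TP]) auto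
  qed
  also have "(\<integral>x. ?u (T x) \<partial>P) = (\<integral>y. ?u y \<partial>Q)"
    by (subst push_forward_of_optimal_potential[symmetric], subst integral_distr[OF TP]) auto
  finally show ?thesis by (simp add: opt dual_value_def)
qed

end

end

section \<open>Multi-marginal plans and barycenters\<close>

definition avg :: "'i set \<Rightarrow> ('i \<Rightarrow> 'a::real_inner) \<Rightarrow> 'a" where
  "avg I s = (1 / real (card I)) *\<^sub>R (\<Sum>i\<in>I. s i)"

text \<open>Huygens' identity: the mean minimises the sum of squared distances, and the identity quantifies
  by how much other points fail to.\<close>

lemma sum_sq_dist_avg:
  fixes s :: "'i \<Rightarrow> 'a::real_inner"
  assumes "finite I" "I \<noteq> {}"
  shows "(\<Sum>i\<in>I. (norm (x - s i))\<^sup>2) =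
    real (card I) * (norm (x - avg I s))\<^sup>2 + (\<Sum>i\<in>I. (norm (avg I s - s i))\<^sup>2)"
proof -
  have card: "real (card I) > 0" using assms by (simp add: card_gt_0_iff)
  then have sum: "(\<Sum>i\<in>I. s i) = real (card I) *\<^sub>R avg I s" by (simp add: avg_def)
  have exp: "(norm (x - s i))\<^sup>2 = (norm (x - avg I s))\<^sup>2 + (norm (avg I s - s i))\<^sup>2
      + 2 * ((x - avg I s) \<bullet> (avg I s - s i))" for i
    by (simp add: power2_norm_eq_inner inner_diff inner_commute algebra_simps)
  have "(\<Sum>i\<in>I. (x - avg I s) \<bullet> (avg I s - s i)) = (x - avg I s) \<bullet> (\<Sum>i\<in>I. avg I s - s i)"
    by (simp add: inner_sum_right)
  also have "(\<Sum>i\<in>I. avg I s - s i) = 0" by (simp add: sum_subtractf sum sum_constant_scaleR)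
  finally have "(\<Sum>i\<in>I. (x - avg I s) \<bullet> (avg I s - s i)) = 0" by simp
  then show ?thesis unfolding exp by (simp add: sum.distrib flip: sum_distrib_left)
qed

text \<open>A transport plan \<open>\<pi>\<close> between the supports yields a competitor for the barycenter: the law of the
  mean \<open>avg I s\<close> when \<open>s\<close> is drawn from \<open>\<pi>\<close>. The joint law of \<open>avg I s\<close> and \<open>s i\<close> couples it to
  \<open>P i\<close>, so its objective value is at most the multi-marginal cost of \<open>\<pi>\<close>.\<close>

lemma barycenter_le_multimarginal_cost:
  fixes P :: "'i \<Rightarrow> 'a::euclidean_space measure"
  assumes I: "finite I" "I \<noteq> {}" and P: "\<And>i. i \<in> I \<Longrightarrow> discrete_prob (P i)"
    and \<pi>0: "\<And>s. s \<in> Pi\<^sub>E I (\<lambda>i. supp (P i)) \<Longrightarrow> 0 \<le> \<pi> s"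
    and marg: "\<And>i y. i \<in> I \<Longrightarrow> y \<in> supp (P i) \<Longrightarrow>
      (\<Sum>s | s \<in> Pi\<^sub>E I (\<lambda>i. supp (P i)) \<and> s i = y. \<pi> s) = measure (P i) {y}"
  shows "(INF Q\<in>P2. \<Sum>i\<in>I. (W2 Q (P i))\<^sup>2) \<le>
    (\<Sum>s\<in>Pi\<^sub>E I (\<lambda>i. supp (P i)). \<pi> s * (\<Sum>i\<in>I. (norm (avg I s - s i))\<^sup>2))"
proof -
  let ?A = "Pi\<^sub>E I (\<lambda>i. supp (P i))"
  have finS: "finite (supp (P i))" if "i \<in> I" for i using P[OF that] by (simp add: discrete_prob_def)
  have finA: "finite ?A" using I finS by (intro finite_PiE) auto
  have split: "(\<Sum>s\<in>?A. \<pi> s * f (s i)) = (\<integral>y. f y \<partial>P i)"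
    if i: "i \<in> I" and f: "f \<in> borel_measurable borel" for i and f :: "'a \<Rightarrow> real"
  proof -
    have "(\<Sum>s\<in>?A. \<pi> s * f (s i)) = (\<Sum>y\<in>supp (P i). \<Sum>s | s \<in> ?A \<and> s i = y. \<pi> s * f (s i))"
      using finA finS[OF i] i by (intro sum.group[symmetric]) auto
    also have "\<dots> = (\<Sum>y\<in>supp (P i). f y * measure (P i) {y})"
      by (intro sum.cong refl) (simp add: marg[OF i, symmetric] sum_distrib_left mult.commute)
    also have "\<dots> = (\<integral>y. f y \<partial>P i)" by (rule integral_finite_supp(2)[OF P[OF i] f, symmetric])
    finally show ?thesis .
  qed
  define w where "w = (\<lambda>s. if s \<in> ?A then \<pi> s else 0)"
  have w0: "0 \<le> w s" for s using \<pi>0 by (simp add: w_def)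
  have w1: "(\<integral>\<^sup>+ s. ennreal (w s) \<partial>count_space UNIV) = 1"
  proof -
    obtain i where i: "i \<in> I" using I by blast
    interpret prob_space "P i" using P[OF i] by (simp add: discrete_prob_def borel_prob_def)
    have "(\<integral>\<^sup>+ s. ennreal (w s) \<partial>count_space UNIV) = (\<Sum>s\<in>?A. ennreal (w s))"
      using finA by (intro nn_integral_count_space') (auto simp: w_def)
    also have "\<dots> = ennreal (\<Sum>s\<in>?A. w s)" using w0 by (rule sum_ennreal)
    also have "(\<Sum>s\<in>?A. w s) = (\<Sum>s\<in>?A. \<pi> s * 1)" by (intro sum.cong) (auto simp: w_def)
    also have "\<dots> = 1" using split[OF i, of "\<lambda>_. 1"] prob_space by simp
    finally show ?thesis by simp
  qed
  define p where "p = embed_pmf w"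
  have pmf: "pmf p s = w s" for s unfolding p_def by (rule pmf_embed_pmf[OF w0 w1])
  have setp: "set_pmf p \<subseteq> ?A" by (auto simp: set_pmf_eq pmf w_def split: if_splits)
  have finp: "finite (set_pmf p)" using setp finA by (rule finite_subset)
  have int: "integrable (measure_pmf p) g" for g :: "_ \<Rightarrow> real"
    using finp by (rule integrable_measure_pmf_finite)
  have E: "(\<integral>s. g s \<partial>measure_pmf p) = (\<Sum>s\<in>?A. \<pi> s * g s)" for g :: "_ \<Rightarrow> real"
  proof -
    have "(\<integral>s. g s \<partial>measure_pmf p) = (\<Sum>s\<in>?A. pmf p s *\<^sub>R g s)"
      using finA setp by (intro integral_measure_pmf) auto
    also have "\<dots> = (\<Sum>s\<in>?A. \<pi> s * g s)" by (intro sum.cong) (auto simp: pmf w_def)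
    finally show ?thesis .
  qed
  define Q where "Q = distr (measure_pmf p) borel (avg I)"
  have Q: "Q \<in> P2"
  proof (rule P2_I)
    show "borel_prob Q"
      unfolding borel_prob_def Q_def by (auto intro!: measure_pmf.prob_space_distr)
    show "integrable Q (\<lambda>x. (norm x)\<^sup>2)"
      unfolding Q_def by (subst integrable_distr_eq) (auto intro: int)
  qed
  have W: "(W2 Q (P i))\<^sup>2 \<le> (\<Sum>s\<in>?A. \<pi> s * (norm (avg I s - s i))\<^sup>2)" if i: "i \<in> I" for i
  proof -
    define \<gamma> where "\<gamma> = distr (measure_pmf p) (borel \<Otimes>\<^sub>M borel) (\<lambda>s. (avg I s, s i))"
    have snd: "distr (measure_pmf p) borel (\<lambda>s. s i) = P i"
    proof (rule measure_eqI)
      have bp: "borel_prob (P i)" using P[OF i] by (simp add: discrete_prob_def)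
      then show "sets (distr (measure_pmf p) borel (\<lambda>s. s i)) = sets (P i)"
        by (simp add: borel_prob_def)
      interpret Pi: prob_space "P i" using bp by (simp add: borel_prob_def)
      fix B assume "B \<in> sets (distr (measure_pmf p) borel (\<lambda>s. s i))"
      then have B: "B \<in> sets borel" by simp
      have "measure (distr (measure_pmf p) borel (\<lambda>s. s i)) B = measure (measure_pmf p) ((\<lambda>s. s i) -` B)"
        using B by (simp add: measure_distr)
      also have "\<dots> = (\<integral>s. indicator ((\<lambda>s. s i) -` B) s \<partial>measure_pmf p)" by simp
      also have "\<dots> = (\<Sum>s\<in>?A. \<pi> s * indicator B (s i))"
        unfolding E by (intro sum.cong) (auto simp: indicator_def)
      also have "\<dots> = (\<integral>y. indicator B y \<partial>P i)" using B by (intro split i) auto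
      also have "\<dots> = measure (P i) B" using B borel_probD[OF bp] by simp
      finally show "emeasure (distr (measure_pmf p) borel (\<lambda>s. s i)) B = emeasure (P i) B"
        by (simp add: Pi.emeasure_eq_measure
            finite_measure.emeasure_eq_measure[OF prob_space.finite_measure[OF measure_pmf.prob_space_distr]])
    qed
    have meas: "(\<lambda>s. (avg I s, s i)) \<in> measurable (measure_pmf p) (borel \<Otimes>\<^sub>M borel)"
      by (simp add: space_pair_measure)
    have "\<gamma> \<in> couplings Q (P i)"
      unfolding couplings_def
    proof (intro CollectI conjI)
      show "prob_space \<gamma>" unfolding \<gamma>_def using meas by (rule measure_pmf.prob_space_distr)
      show "sets \<gamma> = sets (borel \<Otimes>\<^sub>M borel)" by (simp add: \<gamma>_def)
      show "distr \<gamma> borel fst = Q"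
        unfolding \<gamma>_def Q_def by (subst distr_distr[OF _ meas]) (simp_all add: comp_def)
      show "distr \<gamma> borel snd = P i"
        unfolding \<gamma>_def by (subst distr_distr[OF _ meas]) (simp_all add: comp_def snd)
    qed
    then have "(W2 Q (P i))\<^sup>2 \<le> (\<integral>z. (norm (fst z - snd z))\<^sup>2 \<partial>\<gamma>)"
      by (rule W2_sq_le[OF _ Q discrete_prob_P2[OF P[OF i]]])
    also have "\<dots> = (\<integral>s. (norm (avg I s - s i))\<^sup>2 \<partial>measure_pmf p)"
      unfolding \<gamma>_def by (subst integral_distr[OF meas]) auto
    finally show ?thesis unfolding E .
  qed
  have "(INF Q\<in>P2. \<Sum>i\<in>I. (W2 Q (P i))\<^sup>2) \<le> (\<Sum>i\<in>I. (W2 Q (P i))\<^sup>2)"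
    using Q by (intro cINF_lower bdd_belowI2[where m = 0]) (auto intro: sum_nonneg)
  also have "\<dots> \<le> (\<Sum>i\<in>I. \<Sum>s\<in>?A. \<pi> s * (norm (avg I s - s i))\<^sup>2)" by (intro sum_mono W)
  also have "\<dots> = (\<Sum>s\<in>?A. \<pi> s * (\<Sum>i\<in>I. (norm (avg I s - s i))\<^sup>2))"
    by (subst sum.swap) (simp add: sum_distrib_left)
  finally show ?thesis .
qed

section \<open>Convex potentials of a barycenter\<close>

text \<open>Optimal dual variables \<open>u\<close> of the multi-marginal problem, rewritten as \<open>u i y = \<bar>y\<bar>\<^sup>2 - 2 * h i y\<close>.
  Dual feasibility says that \<open>\<Sum>i\<in>I. \<bar>x - s i\<bar>\<^sup>2 - u i (s i)\<close> is nonnegative at \<open>x = avg I s\<close>, and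
  Huygens' identity upgrades this to a quadratic lower bound in \<open>x\<close>. That bound is what later
  singles out \<open>avg I s\<close>.\<close>

lemma optimal_barycenter_potentials:
  fixes P :: "'i \<Rightarrow> 'a::euclidean_space measure"
  assumes I: "finite I" "I \<noteq> {}" and P: "\<And>i. i \<in> I \<Longrightarrow> discrete_prob (P i)"
  obtains h :: "'i \<Rightarrow> 'a \<Rightarrow> real" where
    "\<And>i. i \<in> I \<Longrightarrow> h i \<in> borel_measurable borel"
    "\<And>x s. s \<in> Pi\<^sub>E I (\<lambda>i. supp (P i)) \<Longrightarrow>
      real (card I) * (norm (x - avg I s))\<^sup>2 \<le> (\<Sum>i\<in>I. (norm x)\<^sup>2 - 2 * (x \<bullet> s i - h i (s i)))"
    "(INF Q\<in>P2. \<Sum>i\<in>I. (W2 Q (P i))\<^sup>2) \<le> (\<Sum>i\<in>I. \<integral>y. (norm y)\<^sup>2 - 2 * h i y \<partial>P i)"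
proof -
  let ?A = "Pi\<^sub>E I (\<lambda>i. supp (P i))"
  let ?c = "\<lambda>s. \<Sum>i\<in>I. (norm (avg I s - s i))\<^sup>2"
  have finS: "finite (supp (P i))" if "i \<in> I" for i using P[OF that] by (simp add: discrete_prob_def)
  have "\<exists>u. (\<forall>s\<in>?A. (\<Sum>i\<in>I. u i (s i)) \<le> ?c s) \<and>
      (INF Q\<in>P2. \<Sum>i\<in>I. (W2 Q (P i))\<^sup>2) \<le> (\<Sum>i\<in>I. \<Sum>y\<in>supp (P i). u i y * measure (P i) {y})"
    by (intro multimarginal_duality I finS barycenter_le_multimarginal_cost[OF I P])
  then obtain u where feas: "\<And>s. s \<in> ?A \<Longrightarrow> (\<Sum>i\<in>I. u i (s i)) \<le> ?c s"
    and val: "(INF Q\<in>P2. \<Sum>i\<in>I. (W2 Q (P i))\<^sup>2) \<le> (\<Sum>i\<in>I. \<Sum>y\<in>supp (P i). u i y * measure (P i) {y})"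
    by blast
  \<comment> \<open>The indicators make \<open>h i\<close> vanish off the support, hence Borel measurable.\<close>
  define h where "h = (\<lambda>i y. \<Sum>z\<in>supp (P i). ((norm z)\<^sup>2 - u i z) / 2 * indicator {z} y)"
  have h: "h i y = ((norm y)\<^sup>2 - u i y) / 2" if "i \<in> I" "y \<in> supp (P i)" for i y
  proof -
    have "h i y = (\<Sum>z\<in>supp (P i). if z = y then ((norm y)\<^sup>2 - u i y) / 2 else 0)"
      unfolding h_def by (intro sum.cong) auto
    then show ?thesis using that finS[OF that(1)] by simp
  qed
  have meas: "h i \<in> borel_measurable borel" for i unfolding h_def by measurable
  show ?thesis
  proof (rule that)
    show "h i \<in> borel_measurable borel" for i by (rule meas)
    fix x s assume s: "s \<in> ?A"
    have "(\<Sum>i\<in>I. (norm x)\<^sup>2 - 2 * (x \<bullet> s i - h i (s i))) = (\<Sum>i\<in>I. (norm (x - s i))\<^sup>2 - u i (s i))"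
    proof (intro sum.cong refl)
      fix i assume i: "i \<in> I"
      then have "s i \<in> supp (P i)" using s by auto
      then show "(norm x)\<^sup>2 - 2 * (x \<bullet> s i - h i (s i)) = (norm (x - s i))\<^sup>2 - u i (s i)"
        by (simp add: h[OF i] power2_norm_eq_inner inner_diff inner_commute field_simps)
    qed
    also have "\<dots> = real (card I) * (norm (x - avg I s))\<^sup>2 + ?c s - (\<Sum>i\<in>I. u i (s i))"
      by (simp add: sum_subtractf sum_sq_dist_avg[OF I, of x s])
    finally show "real (card I) * (norm (x - avg I s))\<^sup>2
        \<le> (\<Sum>i\<in>I. (norm x)\<^sup>2 - 2 * (x \<bullet> s i - h i (s i)))"
      using feas[OF s] by linarith
  next
    have "(\<integral>y. (norm y)\<^sup>2 - 2 * h i y \<partial>P i) = (\<Sum>y\<in>supp (P i). u i y * measure (P i) {y})"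
      if i: "i \<in> I" for i
    proof -
      have m: "(\<lambda>y. (norm y)\<^sup>2 - 2 * h i y) \<in> borel_measurable borel" using meas[of i] by measurable
      show ?thesis
        unfolding integral_finite_supp(2)[OF P[OF i] m] by (intro sum.cong) (auto simp: h[OF i] field_simps)
    qed
    then show "(INF Q\<in>P2. \<Sum>i\<in>I. (W2 Q (P i))\<^sup>2) \<le> (\<Sum>i\<in>I. \<integral>y. (norm y)\<^sup>2 - 2 * h i y \<partial>P i)"
      using val by simp
  qed
qed

text \<open>The potentials \<open>\<psi> i\<close> do not depend on \<open>B\<close>. The function \<open>\<Phi>\<close> is the sum of the \<open>c\<close>-transforms of the
  optimal dual variables. It is nonnegative. Because weak duality holds for each \<open>i\<close> while the
  integrals of the dual variables add up to at least the infimum, a barycenter has \<open>\<integral>\<Phi> dB = 0\<close>, and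
  each \<open>h i\<close> is optimal for the pair of \<open>B\<close> and \<open>P i\<close>. At a point \<open>x\<close> with \<open>\<Phi> x = 0\<close> every choice of active
  slopes has mean \<open>x\<close>. Changing a single slope would change the mean, so the active slopes
  are unique: \<open>x\<close> lies in an open cell of each \<open>\<psi> i\<close>, the gradients are these slopes, and there are
  only finitely many such \<open>x\<close>.\<close>

theorem barycenter_potentials:
  fixes P :: "'i \<Rightarrow> 'a::euclidean_space measure"
  assumes I: "finite I" "I \<noteq> {}" and P: "\<And>i. i \<in> I \<Longrightarrow> discrete_prob (P i)"
    and B: "B \<in> P2"
    and bary: "(\<Sum>i\<in>I. (W2 B (P i))\<^sup>2) = (INF Q\<in>P2. \<Sum>i\<in>I. (W2 Q (P i))\<^sup>2)"
  obtains \<psi> :: "'i \<Rightarrow> 'a \<Rightarrow> real" where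
    "\<And>i. i \<in> I \<Longrightarrow> convex_on UNIV (\<psi> i)"
    "\<And>i x. i \<in> I \<Longrightarrow> x \<in> supp B \<Longrightarrow> \<psi> i differentiable (at x)"
    "\<And>i. i \<in> I \<Longrightarrow> grad (\<psi> i) \<in> borel_measurable borel"
    "\<And>i. i \<in> I \<Longrightarrow> distr B borel (grad (\<psi> i)) = P i"
    "\<And>i. i \<in> I \<Longrightarrow> (\<integral>x. (norm (x - grad (\<psi> i) x))\<^sup>2 \<partial>B) = (W2 B (P i))\<^sup>2"
    "\<And>x. x \<in> supp B \<Longrightarrow> avg I (\<lambda>i. grad (\<psi> i) x) = x"
    "\<And>x. x \<in> supp B \<Longrightarrow> avg I (\<lambda>i. \<psi> i x) = (norm x)\<^sup>2 / 2"
proof -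
  let ?A = "Pi\<^sub>E I (\<lambda>i. supp (P i))"
  obtain h where h: "\<And>i. i \<in> I \<Longrightarrow> h i \<in> borel_measurable borel"
    and contact: "\<And>x s. s \<in> ?A \<Longrightarrow>
      real (card I) * (norm (x - avg I s))\<^sup>2 \<le> (\<Sum>i\<in>I. (norm x)\<^sup>2 - 2 * (x \<bullet> s i - h i (s i)))"
    and val: "(INF Q\<in>P2. \<Sum>i\<in>I. (W2 Q (P i))\<^sup>2) \<le> (\<Sum>i\<in>I. \<integral>y. (norm y)\<^sup>2 - 2 * h i y \<partial>P i)"
    using optimal_barycenter_potentials[of I P, OF I P] by blast
  define \<psi> where "\<psi> = (\<lambda>i. max_affine (supp (P i)) (h i))"
  define \<Phi> where "\<Phi> = (\<lambda>x. \<Sum>i\<in>I. (norm x)\<^sup>2 - 2 * \<psi> i x)"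
  have cardI: "real (card I) > 0" using I by (simp add: card_gt_0_iff)
  have S: "finite (supp (P i))" "supp (P i) \<noteq> {}" if "i \<in> I" for i
    using P[OF that] supp_nonempty[of "P i"] by (auto simp: discrete_prob_def)
  have finA: "finite ?A" using I S by (intro finite_PiE) auto
  have contact': "real (card I) * (norm (x - avg I s))\<^sup>2 \<le> \<Phi> x"
    if "s \<in> ?A" "\<And>i. i \<in> I \<Longrightarrow> \<psi> i x = x \<bullet> s i - h i (s i)" for x s
    using contact[OF that(1), of x] that(2) by (simp add: \<Phi>_def)
  have active: "\<exists>s\<in>?A. \<forall>i\<in>I. \<psi> i x = x \<bullet> s i - h i (s i)" for x
  proof -
    have "\<exists>y\<in>supp (P i). \<psi> i x = x \<bullet> y - h i y" if "i \<in> I" for i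
      using max_affine_attained[OF S[OF that]] unfolding \<psi>_def by blast
    then obtain y where "\<forall>i\<in>I. y i \<in> supp (P i) \<and> \<psi> i x = x \<bullet> y i - h i (y i)" by metis
    then show ?thesis by (intro bexI[of _ "restrict y I"]) auto
  qed
  have \<Phi>0: "0 \<le> \<Phi> x" for x
  proof -
    obtain s where s: "s \<in> ?A" "\<forall>i\<in>I. \<psi> i x = x \<bullet> s i - h i (s i)" using active by blast
    have "0 \<le> real (card I) * (norm (x - avg I s))\<^sup>2" by simp
    also have "\<dots> \<le> \<Phi> x" using s by (intro contact') auto
    finally show ?thesis .
  qed
  have int: "integrable B (\<lambda>x. (norm x)\<^sup>2 - 2 * \<psi> i x)" if "i \<in> I" for i
    unfolding \<psi>_def using P2_D[OF B] integrable_max_affine[OF S[OF that] B] by simp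
  have dual: "dual_value B (P i) (h i)
      = (\<integral>x. (norm x)\<^sup>2 - 2 * \<psi> i x \<partial>B) + (\<integral>y. (norm y)\<^sup>2 - 2 * h i y \<partial>P i)" for i
    by (simp add: dual_value_def \<psi>_def)
  have weak: "dual_value B (P i) (h i) \<le> (W2 B (P i))\<^sup>2" if "i \<in> I" for i
    by (rule W2_sq_ge_dual_value[OF B P[OF that] h[OF that]])
  have int\<Phi>: "integrable B \<Phi>" unfolding \<Phi>_def using int by (rule Bochner_Integration.integrable_sum)
  have sum_dual: "(\<Sum>i\<in>I. dual_value B (P i) (h i))
      = (\<integral>x. \<Phi> x \<partial>B) + (\<Sum>i\<in>I. \<integral>y. (norm y)\<^sup>2 - 2 * h i y \<partial>P i)"
    unfolding dual \<Phi>_def using int by (simp add: sum.distrib Bochner_Integration.integral_sum)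
  have sum_le: "(\<Sum>i\<in>I. dual_value B (P i) (h i)) \<le> (\<Sum>i\<in>I. (W2 B (P i))\<^sup>2)"
    by (intro sum_mono weak)
  have int0: "0 \<le> (\<integral>x. \<Phi> x \<partial>B)" using \<Phi>0 by (intro integral_nonneg_AE AE_I2)
  have zero: "(\<integral>x. \<Phi> x \<partial>B) = 0" and
    sum_eq: "(\<Sum>i\<in>I. (W2 B (P i))\<^sup>2 - dual_value B (P i) (h i)) = 0"
    using sum_dual sum_le int0 val bary by (simp_all add: sum_subtractf)
  have opt: "(W2 B (P i))\<^sup>2 = dual_value B (P i) (h i)" if "i \<in> I" for i
    using sum_eq weak that I by (subst (asm) sum_nonneg_eq_0_iff) auto
  have cont: "continuous_on UNIV \<Phi>"
    unfolding \<Phi>_def \<psi>_def by (intro continuous_intros continuous_on_max_affine S)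
  have \<Phi>_supp: "\<Phi> x = 0" if x: "x \<in> supp B" for x
  proof -
    have "AE x in B. x \<in> {x. \<Phi> x = 0}"
      using zero integral_nonneg_eq_0_iff_AE[OF int\<Phi>] \<Phi>0 by simp
    moreover have "closed {x. \<Phi> x = 0}" using cont by (intro closed_Collect_eq continuous_intros)
    ultimately show ?thesis using supp_subset_closed[OF P2_D(1)[OF B]] x by blast
  qed
  have mean: "x = avg I s"
    if x: "x \<in> supp B" and s: "s \<in> ?A" "\<And>i. i \<in> I \<Longrightarrow> \<psi> i x = x \<bullet> s i - h i (s i)" for x s
  proof -
    have "real (card I) * (norm (x - avg I s))\<^sup>2 \<le> 0" using contact'[OF s] \<Phi>_supp[OF x] by simp
    then have "(norm (x - avg I s))\<^sup>2 \<le> 0" using cardI by (simp add: mult_le_0_iff)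
    then show ?thesis by simp
  qed
  have in_cell: "x \<in> laguerre_cell (supp (P i)) (h i) (s i)"
    if x: "x \<in> supp B" and s: "s \<in> ?A" "\<And>i. i \<in> I \<Longrightarrow> \<psi> i x = x \<bullet> s i - h i (s i)"
      and i: "i \<in> I" for x s i
  proof -
    have "x \<bullet> z - h i z < x \<bullet> s i - h i (s i)" if z: "z \<in> supp (P i)" "z \<noteq> s i" for z
    proof (rule ccontr)
      assume "\<not> ?thesis"
      then have zact: "\<psi> i x = x \<bullet> z - h i z"
        using s(2)[OF i] max_affine_ge[OF S[OF i] z(1), of x "h i"] by (simp add: \<psi>_def)
      \<comment> \<open>Exchanging one active slope for another must leave the mean unchanged.\<close>
      have "avg I (s(i := z)) = x"
      proof (rule mean[OF x, symmetric])
        show "s(i := z) \<in> ?A" using s(1) i z(1) by (auto simp: PiE_def extensional_def)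
        show "\<psi> j x = x \<bullet> (s(i := z)) j - h j ((s(i := z)) j)" if "j \<in> I" for j
          using s(2)[OF that] zact by (cases "j = i") simp_all
      qed
      moreover have "avg I s = x" by (rule mean[OF x s, symmetric])
      moreover have "(\<Sum>j\<in>I. f j) = real (card I) *\<^sub>R avg I f" for f :: "'i \<Rightarrow> 'a"
        using cardI by (simp add: avg_def)
      ultimately have "(\<Sum>j\<in>I. (s(i := z)) j) = (\<Sum>j\<in>I. s j)" by metis
      moreover have "(\<Sum>j\<in>I. (s(i := z)) j) = z + (\<Sum>j\<in>I - {i}. s j)"
        using I i by (simp add: sum.remove[of I i])
      ultimately show False using z(2) I i by (simp add: sum.remove[of I i s])
    qed
    then show ?thesis by (auto simp: laguerre_cell_def)
  qed
  have grad_in: "grad (\<psi> i) x \<in> supp (P i)" "x \<in> laguerre_cell (supp (P i)) (h i) (grad (\<psi> i) x)"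
    "\<psi> i differentiable (at x)"
    and avg_grad: "avg I (\<lambda>i. grad (\<psi> i) x) = x"
    if x: "x \<in> supp B" and i: "i \<in> I" for x i
  proof -
    obtain s where s: "s \<in> ?A" "\<And>i. i \<in> I \<Longrightarrow> \<psi> i x = x \<bullet> s i - h i (s i)" using active by metis
    have si: "s j \<in> supp (P j)" if "j \<in> I" for j using s(1) that by auto
    have g: "grad (\<psi> j) x = s j" if "j \<in> I" for j
      unfolding \<psi>_def by (rule grad_max_affine_cell[OF S[OF that] si[OF that] in_cell[OF x s that]])
    show "grad (\<psi> i) x \<in> supp (P i)" "x \<in> laguerre_cell (supp (P i)) (h i) (grad (\<psi> i) x)"
      using g[OF i] si[OF i] in_cell[OF x s i] by auto
    show "\<psi> i differentiable (at x)"
      unfolding \<psi>_def by (rule max_affine_differentiable_cell[OF S[OF i] si[OF i] in_cell[OF x s i]])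
    have "avg I (\<lambda>i. grad (\<psi> i) x) = avg I s" using g by (simp add: avg_def)
    then show "avg I (\<lambda>i. grad (\<psi> i) x) = x" using mean[OF x s] by simp
  qed
  have fin: "finite (supp B)"
  proof (rule finite_subset)
    show "supp B \<subseteq> avg I ` ?A" using active mean by (metis image_eqI subsetI)
    show "finite (avg I ` ?A)" using finA by simp
  qed
  have meas: "grad (\<psi> i) \<in> borel_measurable borel" if "i \<in> I" for i
    unfolding \<psi>_def by (rule borel_measurable_grad_max_affine[OF S[OF that]])
  show ?thesis
  proof (rule that[of \<psi>])
    fix i assume i: "i \<in> I"
    show "convex_on UNIV (\<psi> i)" unfolding \<psi>_def by (rule convex_on_max_affine[OF S[OF i]])
    show "\<psi> i differentiable (at x)" if "x \<in> supp B" for x by (rule grad_in(3)[OF that i])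
    show "grad (\<psi> i) \<in> borel_measurable borel" by (rule meas[OF i])
    show "distr B borel (grad (\<psi> i)) = P i"
      using grad_in(1,2)[OF _ i]
      by (intro push_forward_of_optimal_potential[OF B P[OF i] h[OF i] opt[OF i] fin meas[OF i]]) auto
    show "(\<integral>x. (norm (x - grad (\<psi> i) x))\<^sup>2 \<partial>B) = (W2 B (P i))\<^sup>2"
      using grad_in(1,2)[OF _ i]
      by (intro cost_of_optimal_potential[OF B P[OF i] h[OF i] opt[OF i] fin meas[OF i]]) auto
  next
    fix x assume x: "x \<in> supp B"
    obtain i where "i \<in> I" using I by blast
    then show "avg I (\<lambda>i. grad (\<psi> i) x) = x" by (rule avg_grad[OF x])
    have "real (card I) * (norm x)\<^sup>2 - 2 * (\<Sum>i\<in>I. \<psi> i x) = 0"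
      using \<Phi>_supp[OF x] by (simp add: \<Phi>_def sum_subtractf flip: sum_distrib_left)
    then show "avg I (\<lambda>i. \<psi> i x) = (norm x)\<^sup>2 / 2" using cardI by (simp add: avg_def field_simps)
  qed
qed

theorem theorem1:
  fixes N :: nat
    and P :: "nat \<Rightarrow> (real ^ 'd) measure"
    and Pbar :: "(real ^ 'd) measure"
    and M :: "'w measure"
    and X :: "'w \<Rightarrow> real ^ 'd"
  assumes "1 \<le> N"
    and "\<And>i. i \<in> {1..N} \<Longrightarrow> discrete_prob (P i)"
    and "wasserstein_barycenter N P Pbar"
    and "prob_space M"
    and "X \<in> borel_measurable M"
    and "distr M borel X = Pbar"
  shows "\<exists>\<psi> :: nat \<Rightarrow> real ^ 'd \<Rightarrow> real.
    (\<forall>i\<in>{1..N}. convex_on UNIV (\<psi> i)) \<and>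
    (\<forall>i\<in>{1..N}. \<forall>x\<in>supp Pbar. \<psi> i differentiable (at x)) \<and>
    (\<forall>i\<in>{1..N}. distr Pbar borel (grad (\<psi> i)) = P i) \<and>
    (\<forall>i\<in>{1..N}. (\<integral>\<omega>. (norm (X \<omega> - grad (\<psi> i) (X \<omega>)))\<^sup>2 \<partial>M) = (W2 Pbar (P i))\<^sup>2) \<and>
    (\<forall>x\<in>supp Pbar. (1 / real N) *\<^sub>R (\<Sum>i = 1..N. grad (\<psi> i) x) = x) \<and>
    (\<forall>x\<in>supp Pbar. (1 / real N) * (\<Sum>i = 1..N. \<psi> i x) = (norm x)\<^sup>2 / 2)"
proof -
  have I: "finite {1..N}" "{1..N} \<noteq> {}" using assms(1) by auto
  have B: "Pbar \<in> P2" "(\<Sum>i\<in>{1..N}. (W2 Pbar (P i))\<^sup>2) = (INF Q\<in>P2. \<Sum>i\<in>{1..N}. (W2 Q (P i))\<^sup>2)"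
    using assms(3) by (auto simp: wasserstein_barycenter_def)
  obtain \<psi> where \<psi>:
    "\<And>i. i \<in> {1..N} \<Longrightarrow> convex_on UNIV (\<psi> i)"
    "\<And>i x. i \<in> {1..N} \<Longrightarrow> x \<in> supp Pbar \<Longrightarrow> \<psi> i differentiable (at x)"
    "\<And>i. i \<in> {1..N} \<Longrightarrow> grad (\<psi> i) \<in> borel_measurable borel"
    "\<And>i. i \<in> {1..N} \<Longrightarrow> distr Pbar borel (grad (\<psi> i)) = P i"
    "\<And>i. i \<in> {1..N} \<Longrightarrow> (\<integral>x. (norm (x - grad (\<psi> i) x))\<^sup>2 \<partial>Pbar) = (W2 Pbar (P i))\<^sup>2"
    "\<And>x. x \<in> supp Pbar \<Longrightarrow> avg {1..N} (\<lambda>i. grad (\<psi> i) x) = x"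
    "\<And>x. x \<in> supp Pbar \<Longrightarrow> avg {1..N} (\<lambda>i. \<psi> i x) = (norm x)\<^sup>2 / 2"
    using barycenter_potentials[of "{1..N}" P Pbar, OF I assms(2) B] by blast
  have "(\<integral>\<omega>. (norm (X \<omega> - grad (\<psi> i) (X \<omega>)))\<^sup>2 \<partial>M) = (W2 Pbar (P i))\<^sup>2"
    if i: "i \<in> {1..N}" for i
  proof -
    note [measurable] = \<psi>(3)[OF i]
    have "(\<integral>x. (norm (x - grad (\<psi> i) x))\<^sup>2 \<partial>distr M borel X)
        = (\<integral>\<omega>. (norm (X \<omega> - grad (\<psi> i) (X \<omega>)))\<^sup>2 \<partial>M)"
      by (rule integral_distr[OF assms(5)]) measurable
    then show ?thesis using \<psi>(5)[OF i] assms(6) by simp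
  qed
  then show ?thesis
    using \<psi>(1,2,4,6,7) by (intro exI[of _ \<psi>]) (simp add: avg_def)
qed

end
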